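(* Let $\mathfrak{g}$ be a split real untwisted affine Kac--Moody algebra, $\mathfrak{k}$ its subalgebra fixed by the Cartan--Chevalley involution, and $\widehat{\mathfrak{k}}$ the Hilbert space completion of $\mathfrak{k}$ with respect to the norm defined by the standard invariant bilinear form. Then the Lie bracket does not close on $\widehat{\mathfrak{k}}$ (there are elements of $\widehat{\mathfrak{k}}$ whose commutator does not exist as an element of $\widehat{\mathfrak{k}}$), so that $\widehat{\mathfrak{k}}$ is not a Hilbert Lie algebra with respect to the standard invariant bilinear form; in fact, $\widehat{\mathfrak{k}}$ is not even a Lie algebra.
   Context: $\mathring{\mathfrak{g}}$ denotes the split real finite-dimensional simple Lie algebra obtained by deleting the affine node of the Dynkin diagram of $\mathfrak{g}$, and $\mathring{\mathfrak{g}}=\mathring{\mathfrak{k}}\oplus\mathring{\mathfrak{p}}$ its decomposition into the $+1$ and $-1$ eigenspaces of its Cartan--Chevalley involution ($e_i\mapsto -f_i$, $f_i\mapsto -e_i$, $h\mapsto -h$). Explicitly $$\mathfrak{k}=(\mathfrak{L}^{+}\otimes\mathring{\mathfrak{k}})\oplus(\mathfrak{L}^{-}\otimes\mathring{\mathfrak{p}}),\qquad [P\otimes x,Q\otimes y]=(PQ)\otimes[x,y],$$ where $\mathfrak{L}^{\pm}$ is the span of $t^n\pm t^{-n}$, $n\ge0$, in $\mathbb{R}[t,t^{-1}]$. The standard invariant bilinear form of $\mathfrak{g}$ restricts to a negative definite invariant form on $\mathfrak{k}$; up to normalisation it is $(P\otimes x\,|\,Q\otimes y)=(\text{constant term of }PQ)\cdot\kappa(x,y)$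 with $\kappa$ the Killing form of $\mathring{\mathfrak{g}}$, and the norm is $\|z\|^2=-(z|z)$. The bracket in question on $\widehat{\mathfrak{k}}$ is the one coming from $\mathfrak{k}$. A Hilbert Lie algebra is in particular a Lie algebra, and in addition requires a constant $C$ with $\|[x,y]\|< C\|x\|\,\|y\|$ for all $x,y$. *)

theory Defs
  imports "HOL-Analysis.Analysis" "HOL-Library.Poly_Mapping"
begin

section \<open>Real Lie algebras\<close>

definition lie_bracket :: "('v::real_vector \<Rightarrow> 'v \<Rightarrow> 'v) \<Rightarrow> bool" where
  "lie_bracket br \<longleftrightarrow>
     bilinear br \<and> (\<forall>x. br x x = 0) \<and>
     (\<forall>x y z. br x (br y z) + br y (br z x) + br z (br x y) = 0)"

definition simple_lie_bracket :: "('v::real_vector \<Rightarrow> 'v \<Rightarrow> 'v) \<Rightarrow> bool" where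
  "simple_lie_bracket br \<longleftrightarrow>
     lie_bracket br \<and> (\<exists>x y. br x y \<noteq> 0) \<and>
     (\<forall>I. subspace I \<and> (\<forall>x. \<forall>y\<in>I. br x y \<in> I) \<longrightarrow> I = {0} \<or> I = UNIV)"

definition lie_generates :: "('v::real_vector \<Rightarrow> 'v \<Rightarrow> 'v) \<Rightarrow> 'v set \<Rightarrow> bool" where
  "lie_generates br G \<longleftrightarrow>
     (\<forall>S. subspace S \<and> G \<subseteq> S \<and> (\<forall>x\<in>S. \<forall>y\<in>S. br x y \<in> S) \<longrightarrow> S = UNIV)"

text \<open>The trace of \<open>ad x \<circ> ad y\<close>, evaluated in the basis of the type class; the trace does not
  depend on the basis, so the inner product of the carrier type plays no role.\<close>

definition killing_form :: "('a::euclidean_space \<Rightarrow> 'a \<Rightarrow> 'a) \<Rightarrow> 'a \<Rightarrow> 'a \<Rightarrow> real" where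
  "killing_form br x y = (\<Sum>b\<in>Basis. br x (br y b) \<bullet> b)"


section \<open>Split real finite-dimensional simple Lie algebras\<close>

definition finite_type_cartan_matrix :: "('i::finite \<Rightarrow> 'i \<Rightarrow> int) \<Rightarrow> bool" where
  "finite_type_cartan_matrix A \<longleftrightarrow>
     (\<forall>i. A i i = 2) \<and>
     (\<forall>i j. i \<noteq> j \<longrightarrow> A i j \<le> 0) \<and>
     (\<forall>i j. A i j = 0 \<longleftrightarrow> A j i = 0) \<and>
     (\<exists>D :: 'i \<Rightarrow> real.
        (\<forall>i. D i > 0) \<and>
        (\<forall>i j. D i * real_of_int (A i j) = D j * real_of_int (A j i)) \<and>
        (\<forall>x :: 'i \<Rightarrow> real. (\<exists>i. x i \<noteq> 0) \<longrightarrow>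
           (\<Sum>i\<in>UNIV. \<Sum>j\<in>UNIV. D i * real_of_int (A i j) * x i * x j) > 0))"

text \<open>A real simple Lie algebra is split iff it has Chevalley generators for a Cartan matrix of
  finite type. The Serre relations need not be listed: they hold automatically in a
  finite-dimensional Lie algebra.\<close>

definition split_simple_lie_algebra ::
  "('a::euclidean_space \<Rightarrow> 'a \<Rightarrow> 'a) \<Rightarrow> ('i::finite \<Rightarrow> 'i \<Rightarrow> int) \<Rightarrow>
   ('i \<Rightarrow> 'a) \<Rightarrow> ('i \<Rightarrow> 'a) \<Rightarrow> ('i \<Rightarrow> 'a) \<Rightarrow> bool" where
  "split_simple_lie_algebra br A e f h \<longleftrightarrow>
     simple_lie_bracket br \<and> finite_type_cartan_matrix A \<and>
     (\<forall>i j. br (h i) (h j) = 0) \<and>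
     (\<forall>i j. br (e i) (f j) = (if i = j then h i else 0)) \<and>
     (\<forall>i j. br (h i) (e j) = real_of_int (A i j) *\<^sub>R e j) \<and>
     (\<forall>i j. br (h i) (f j) = - (real_of_int (A i j) *\<^sub>R f j)) \<and>
     lie_generates br (range e \<union> range f)"

text \<open>These conditions determine \<open>\<omega>\<close>, since the \<open>e i\<close> and \<open>f i\<close> generate.\<close>

definition cartan_chevalley_involution ::
  "('a::real_vector \<Rightarrow> 'a \<Rightarrow> 'a) \<Rightarrow> ('i \<Rightarrow> 'a) \<Rightarrow> ('i \<Rightarrow> 'a) \<Rightarrow> ('i \<Rightarrow> 'a) \<Rightarrow>
   ('a \<Rightarrow> 'a) \<Rightarrow> bool" where
  "cartan_chevalley_involution br e f h \<omega> \<longleftrightarrow>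
     linear \<omega> \<and> (\<forall>x y. \<omega> (br x y) = br (\<omega> x) (\<omega> y)) \<and>
     (\<forall>i. \<omega> (e i) = - f i) \<and> (\<forall>i. \<omega> (f i) = - e i) \<and> (\<forall>i. \<omega> (h i) = - h i)"


section \<open>Untwisted affine Kac--Moody algebras\<close>

instantiation poly_mapping :: (type, real_vector) real_vector
begin

lift_definition scaleR_poly_mapping :: "real \<Rightarrow> ('a \<Rightarrow>\<^sub>0 'b) \<Rightarrow> 'a \<Rightarrow>\<^sub>0 'b"
  is "\<lambda>r P k. r *\<^sub>R P k"
  by (erule finite_subset[rotated]) auto

instance
  by standard (transfer; simp add: fun_eq_iff algebra_simps)+

end

text \<open>
  With \<open>L\<close> the ring of Laurent polynomials over the reals, the type \<open>int \<Rightarrow>\<^sub>0 'a\<close> represents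
  the tensor product of \<open>L\<close> with \<open>'a\<close>, and \<open>Poly_Mapping.single n x\<close> is the tensor
  \<open>t^n \<otimes> x\<close>. A triple \<open>(P, a, b)\<close> of type \<open>'a affine\<close> stands for
  \<open>P + a K + b d\<close>, where \<open>K\<close> is the central element and \<open>d = t d/dt\<close> the derivation.

  The parameter \<open>c > 0\<close> below is the normalisation of the invariant form, \<open>c\<close> times the Killing
  form on the finite-dimensional algebra. The bracket is determined by
  \<open>[t^m \<otimes> x, t^n \<otimes> y] = t^(m+n) \<otimes> [x,y] + m \<delta>(m,-n) (x|y) K\<close> and
  \<open>[d, t^n \<otimes> x] = n t^n \<otimes> x\<close>, with \<open>K\<close> central.
\<close>

type_synonym 'a affine = "(int \<Rightarrow>\<^sub>0 'a) \<times> real \<times> real"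

definition loop_bracket ::
  "('a::real_vector \<Rightarrow> 'a \<Rightarrow> 'a) \<Rightarrow> (int \<Rightarrow>\<^sub>0 'a) \<Rightarrow> (int \<Rightarrow>\<^sub>0 'a) \<Rightarrow> (int \<Rightarrow>\<^sub>0 'a)" where
  "loop_bracket br P Q =
     (\<Sum>m\<in>Poly_Mapping.keys P. \<Sum>n\<in>Poly_Mapping.keys Q.
        Poly_Mapping.single (m + n)
          (br (Poly_Mapping.lookup P m) (Poly_Mapping.lookup Q n)))"

definition loop_derivation :: "(int \<Rightarrow>\<^sub>0 'a::real_vector) \<Rightarrow> (int \<Rightarrow>\<^sub>0 'a)" where
  "loop_derivation P =
     (\<Sum>n\<in>Poly_Mapping.keys P.
        Poly_Mapping.single n (real_of_int n *\<^sub>R Poly_Mapping.lookup P n))"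

definition loop_form ::
  "('a::euclidean_space \<Rightarrow> 'a \<Rightarrow> 'a) \<Rightarrow> real \<Rightarrow> (int \<Rightarrow>\<^sub>0 'a) \<Rightarrow> (int \<Rightarrow>\<^sub>0 'a) \<Rightarrow> real" where
  "loop_form br c P Q =
     (\<Sum>n\<in>Poly_Mapping.keys P.
        c * killing_form br (Poly_Mapping.lookup P n) (Poly_Mapping.lookup Q (- n)))"

fun affine_bracket ::
  "('a::euclidean_space \<Rightarrow> 'a \<Rightarrow> 'a) \<Rightarrow> real \<Rightarrow> 'a affine \<Rightarrow> 'a affine \<Rightarrow> 'a affine" where
  "affine_bracket br c (P, a, b) (Q, a', b') =
     (loop_bracket br P Q + b *\<^sub>R loop_derivation Q - b' *\<^sub>R loop_derivation P,
      loop_form br c (loop_derivation P) Q,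
      0)"

text \<open>The form pairs \<open>K\<close> with \<open>d\<close> by \<open>(K|d) = 1\<close>, while \<open>(K|K) = (d|d) = 0\<close>.\<close>

fun affine_form ::
  "('a::euclidean_space \<Rightarrow> 'a \<Rightarrow> 'a) \<Rightarrow> real \<Rightarrow> 'a affine \<Rightarrow> 'a affine \<Rightarrow> real" where
  "affine_form br c (P, a, b) (Q, a', b') = loop_form br c P Q + a * b' + b * a'"

text \<open>\<open>t^n \<otimes> x \<mapsto> t^(-n) \<otimes> \<omega> x\<close>, \<open>K \<mapsto> -K\<close>, \<open>d \<mapsto> -d\<close>. This exchanges the Chevalley
  generators of the affine algebra up to sign, including a suitably chosen pair at the affine node.\<close>

fun affine_involution :: "('a::real_vector \<Rightarrow> 'a) \<Rightarrow> 'a affine \<Rightarrow> 'a affine" where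
  "affine_involution \<omega> (P, a, b) =
     (\<Sum>n\<in>Poly_Mapping.keys P. Poly_Mapping.single (- n) (\<omega> (Poly_Mapping.lookup P n)),
      - a, - b)"

definition maximal_compact :: "('a::real_vector \<Rightarrow> 'a) \<Rightarrow> 'a affine set" where
  "maximal_compact \<omega> = {z. affine_involution \<omega> z = z}"


section \<open>Hilbert space completions and brackets on them\<close>

text \<open>\<open>\<iota>\<close> identifies the pre-Hilbert space \<open>S\<close>, with inner product \<open>ip\<close>, with a dense subspace of
  the Hilbert space \<open>'h\<close>. Only the values of \<open>\<iota>\<close> on \<open>S\<close> matter.\<close>

definition hilbert_completion ::
  "'v::real_vector set \<Rightarrow> ('v \<Rightarrow> 'v \<Rightarrow> real) \<Rightarrow> ('v \<Rightarrow> 'h::{real_inner, complete_space}) \<Rightarrow> bool" where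
  "hilbert_completion S ip \<iota> \<longleftrightarrow>
     (\<forall>x\<in>S. \<forall>y\<in>S. \<iota> (x + y) = \<iota> x + \<iota> y) \<and>
     (\<forall>r. \<forall>x\<in>S. \<iota> (r *\<^sub>R x) = r *\<^sub>R \<iota> x) \<and>
     (\<forall>x\<in>S. \<forall>y\<in>S. \<iota> x \<bullet> \<iota> y = ip x y) \<and>
     closure (\<iota> ` S) = UNIV"

text \<open>The partial bracket that the completion inherits from \<open>S\<close>: \<open>z\<close> is the commutator of \<open>x\<close> and
  \<open>y\<close> if \<open>x\<close> and \<open>y\<close> have approximations by elements of \<open>S\<close> whose commutators converge to \<open>z\<close>
  when paired with each element of \<open>S\<close>. For the affine algebras this is the coefficientwise
  commutator of square-summable Laurent series. If the form is invariant and each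
  \<open>br v\<close> is bounded on \<open>S\<close>, the limits always exist as numbers and do not depend on the approximations, so what can fail
  is only that they are represented by an element of the completion. Commutators existing as
  limits in norm are included.\<close>

definition completed_commutator ::
  "'v set \<Rightarrow> ('v \<Rightarrow> 'v \<Rightarrow> 'v) \<Rightarrow> ('v \<Rightarrow> 'h::real_inner) \<Rightarrow> 'h \<Rightarrow> 'h \<Rightarrow> 'h \<Rightarrow> bool" where
  "completed_commutator S br \<iota> x y z \<longleftrightarrow>
     (\<exists>u v. (\<forall>n. u n \<in> S) \<and> (\<forall>n. v n \<in> S) \<and>
        (\<lambda>n. \<iota> (u n)) \<longlonglongrightarrow> x \<and> (\<lambda>n. \<iota> (v n)) \<longlonglongrightarrow> y \<and>
        (\<forall>w\<in>S. (\<lambda>n. \<iota> (br (u n) (v n)) \<bullet> \<iota> w) \<longlonglongrightarrow> z \<bullet> \<iota> w))"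

definition extends_bracket ::
  "'v set \<Rightarrow> ('v \<Rightarrow> 'v \<Rightarrow> 'v) \<Rightarrow> ('v \<Rightarrow> 'h) \<Rightarrow> ('h \<Rightarrow> 'h \<Rightarrow> 'h) \<Rightarrow> bool" where
  "extends_bracket S br \<iota> b \<longleftrightarrow> (\<forall>u\<in>S. \<forall>v\<in>S. b (\<iota> u) (\<iota> v) = \<iota> (br u v))"

text \<open>The bound is not strict, because a strict one fails for \<open>x = 0\<close> in every algebra; for nonzero
  \<open>x\<close> and \<open>y\<close> the two versions agree after enlarging \<open>C\<close>.
  Invariance of the inner product is not demanded.\<close>

definition hilbert_lie_bracket ::
  "('h::{real_inner, complete_space} \<Rightarrow> 'h \<Rightarrow> 'h) \<Rightarrow> bool" where
  "hilbert_lie_bracket b \<longleftrightarrow>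
     lie_bracket b \<and> (\<exists>C. \<forall>x y. norm (b x y) \<le> C * norm x * norm y)"

end

theory Submission
  imports Defs
begin

text \<open>
  Elements of the fixed algebra are Laurent polynomials \<open>\<Sum>n. t ^ n \<otimes> x n\<close> with
  \<open>x (-n) = \<omega> (x n)\<close>, and the form makes them a space of finite sequences with an \<open>\<ell>\<^sup>2\<close> norm. The
  bracket is a convolution, and the theorem holds because \<open>\<ell>\<^sup>2\<close> is not closed under convolution.

  Choose \<open>x\<close> and \<open>y\<close> with \<open>\<omega> x = x\<close>, \<open>\<omega> y = -y\<close> and \<open>[x,y] \<noteq> 0\<close> (\<open>noncommuting_even_odd\<close>), and
  let \<open>P = \<Sum>n>0. a n * t ^ n\<close>, with \<open>P'\<close> its image under inversion of \<open>t\<close>. The commutator of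
  \<open>(P + P') \<otimes> x\<close> and \<open>(P - P') \<otimes> y\<close> is \<open>(P\<^sup>2 - P'\<^sup>2) \<otimes> [x,y]\<close>, in which the positive and negative
  exponents are separated (\<open>even_odd_convolution\<close>). It is thus enough that \<open>a\<close> be square summable
  while its Cauchy square is not, and \<open>a n = n powr (-3/4)\<close> is such a sequence
  (\<open>square_of_l2_sequence_not_l2\<close>).

  Two points need care. First, a completed commutator may be witnessed by arbitrary approximations;
  pairings with a fixed element are bounded bilinear functions of the two arguments
  (\<open>bracket_pairing_bounded\<close>), so the approximations can be exchanged for truncations of the two
  series (\<open>commutator_pairing_independent\<close>). Second, the norm of the completion has to control the
  coefficients, for which the form \<open>-c \<kappa>(x, \<omega> y)\<close> on the finite-dimensional algebra must be definite.
  It is semidefinite since it occurs in an inner product, and definite since the Killing form \<open>\<kappa>\<close> is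
  nondegenerate (\<open>killing_form_nondegenerate\<close>).

  The missing commutator (\<open>commutator_missing\<close>) excludes at once a Lie bracket given by completed
  commutators, and it excludes a Hilbert Lie bracket because a bounded extension would supply every
  commutator (\<open>bounded_extension_gives_commutators\<close>).
\<close>

section \<open>Traces and the Killing form\<close>

lemma trace_commute:
  fixes F G :: "'a::euclidean_space \<Rightarrow> 'a"
  assumes "linear F" "linear G"
  shows "(\<Sum>b\<in>Basis. F (G b) \<bullet> b) = (\<Sum>b\<in>Basis. G (F b) \<bullet> b)"
proof -
  have expand: "(\<Sum>b\<in>Basis. H (K b) \<bullet> b) = (\<Sum>b\<in>Basis. \<Sum>d\<in>Basis. (K b \<bullet> d) * (H d \<bullet> b))"
    if "linear H" for H K :: "'a \<Rightarrow> 'a"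
  proof (rule sum.cong[OF refl])
    fix b :: 'a
    have "H (K b) = H (\<Sum>d\<in>Basis. (K b \<bullet> d) *\<^sub>R d)"
      by (simp add: euclidean_representation)
    also have "\<dots> = (\<Sum>d\<in>Basis. (K b \<bullet> d) *\<^sub>R H d)"
      using that by (simp add: linear_sum linear_scale)
    finally show "H (K b) \<bullet> b = (\<Sum>d\<in>Basis. (K b \<bullet> d) * (H d \<bullet> b))"
      by (simp add: inner_sum_left)
  qed
  show ?thesis
    unfolding expand[OF assms(1)] expand[OF assms(2)]
    by (subst sum.swap) (simp add: mult.commute)
qed

text \<open>
  In a basis of eigenvectors the trace of \<open>T\<^sup>2\<close> is the sum of the squares of the real
  eigenvalues. The proof passes from the orthonormal basis of the carrier to the eigenbasis by
  means of the coordinate functionals.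
\<close>

lemma trace_square_pos:
  fixes T :: "'a::euclidean_space \<Rightarrow> 'a"
  assumes lin: "linear T" and span: "span {v. \<exists>r. T v = r *\<^sub>R v} = UNIV" and "T x0 \<noteq> 0"
  shows "(\<Sum>b\<in>Basis. T (T b) \<bullet> b) > 0"
proof -
  obtain B where B: "B \<subseteq> {v. \<exists>r. T v = r *\<^sub>R v}" "independent B"
    "{v. \<exists>r. T v = r *\<^sub>R v} \<subseteq> span B"
    using maximal_independent_subset by blast
  have sB: "span B = UNIV"
    using span_minimal[OF B(3) subspace_span] span by auto
  have fin: "finite B" using B(2) by (rule independent_imp_finite)
  have "\<forall>v\<in>B. \<exists>r. T v = r *\<^sub>R v" using B(1) by blast
  then obtain r where r: "\<And>v. v \<in> B \<Longrightarrow> T v = r v *\<^sub>R v" by metis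
  let ?c = "\<lambda>x v. representation B x v"
  have rep: "(\<Sum>v\<in>B. ?c x v *\<^sub>R v) = x" for x
    by (rule sum_representation_eq[OF B(2)]) (use sB fin in auto)
  have linc: "linear (\<lambda>x. ?c x v)" for v
    by (rule linearI) (use B(2) sB in \<open>auto simp: representation_add representation_scale\<close>)
  have TT: "T (T x) = (\<Sum>v\<in>B. (?c x v * (r v)\<^sup>2) *\<^sub>R v)" for x
  proof -
    have "T (T x) = T (T (\<Sum>v\<in>B. ?c x v *\<^sub>R v))" by (simp add: rep)
    also have "\<dots> = (\<Sum>v\<in>B. ?c x v *\<^sub>R T (T v))"
      using lin by (simp add: linear_sum linear_scale)
    also have "\<dots> = (\<Sum>v\<in>B. (?c x v * (r v)\<^sup>2) *\<^sub>R v)"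
      by (intro sum.cong refl) (use lin in \<open>simp add: r linear_scale power2_eq_square\<close>)
    finally show ?thesis .
  qed
  have "(\<Sum>b\<in>Basis. T (T b) \<bullet> b) = (\<Sum>v\<in>B. (r v)\<^sup>2 * (\<Sum>b\<in>Basis. (v \<bullet> b) * ?c b v))"
    by (simp add: TT inner_sum_left sum_distrib_left mult_ac) (rule sum.swap)
  also have "\<dots> = (\<Sum>v\<in>B. (r v)\<^sup>2 * ?c (\<Sum>b\<in>Basis. (v \<bullet> b) *\<^sub>R b) v)"
    by (simp add: linear_sum[OF linc] linear_scale[OF linc])
  also have "\<dots> = (\<Sum>v\<in>B. (r v)\<^sup>2)"
    using B(2) by (intro sum.cong refl) (simp add: euclidean_representation representation_basis)
  finally have tr: "(\<Sum>b\<in>Basis. T (T b) \<bullet> b) = (\<Sum>v\<in>B. (r v)\<^sup>2)" .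
  have "\<exists>v\<in>B. r v \<noteq> 0"
  proof (rule ccontr)
    assume "\<not> ?thesis"
    then have "T (\<Sum>v\<in>B. ?c x0 v *\<^sub>R v) = 0"
      using lin by (simp add: linear_sum linear_scale r)
    with assms(3) show False by (simp add: rep)
  qed
  then obtain v where "v \<in> B" "r v \<noteq> 0" by blast
  then show ?thesis unfolding tr using fin by (intro sum_pos2[of B v]) auto
qed

lemma lie_bracket_properties:
  assumes "lie_bracket br"
  shows "bilinear br" "br x y = - br y x"
    "br x (br y z) = br (br x y) z + br y (br x z)"
proof -
  show bil: "bilinear br" using assms by (simp add: lie_bracket_def)
  have alt: "br u u = 0" for u using assms by (simp add: lie_bracket_def)
  have anti: "br u v = - br v u" for u v
    using alt[of "u + v"] alt[of u] alt[of v]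
    by (simp add: bilinear_ladd[OF bil] bilinear_radd[OF bil] eq_neg_iff_add_eq_0 add.commute)
  show "br x y = - br y x" by (rule anti)
  have "br x (br y z) + br y (br z x) + br z (br x y) = 0"
    using assms by (simp add: lie_bracket_def)
  moreover have "br y (br z x) = - br y (br x z)"
    by (subst anti[of z x]) (simp add: bilinear_rneg[OF bil])
  moreover have "br z (br x y) = - br (br x y) z" by (rule anti)
  ultimately show "br x (br y z) = br (br x y) z + br y (br x z)"
    by (simp add: algebra_simps)
qed

lemma bilinear_linear: "bilinear br \<Longrightarrow> linear (br x)" "bilinear br \<Longrightarrow> linear (\<lambda>x. br x y)"
  by (auto simp: bilinear_def)

lemma killing_form_bilinear:
  assumes "bilinear br"
  shows "bilinear (killing_form br)"
  unfolding bilinear_def killing_form_def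
  by (auto intro!: linearI simp: bilinear_ladd[OF assms] bilinear_radd[OF assms]
      bilinear_lmul[OF assms] bilinear_rmul[OF assms] inner_add_left sum.distrib sum_distrib_left)

lemma killing_form_commute:
  assumes "bilinear br"
  shows "killing_form br x y = killing_form br y x"
  unfolding killing_form_def by (rule trace_commute) (rule bilinear_linear[OF assms])+

text \<open>
  Since \<open>ad [x,y]\<close> is the commutator of \<open>ad x\<close> and \<open>ad y\<close>, invariance is cyclicity of
  the trace.
\<close>

lemma killing_form_invariant:
  assumes "lie_bracket br"
  shows "killing_form br (br x y) z = killing_form br x (br y z)"
proof -
  note bil = lie_bracket_properties(1)[OF assms]
  have jac: "br (br u v) w = br u (br v w) - br v (br u w)" for u v w
    using lie_bracket_properties(3)[OF assms, of u v w] by simp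
  have lin: "linear (\<lambda>u. br x (br z u))"
    using linear_compose[OF bilinear_linear(1)[OF bil, of z] bilinear_linear(1)[OF bil, of x]]
    by (simp add: o_def)
  have "(\<Sum>b\<in>Basis. br y (br x (br z b)) \<bullet> b) = (\<Sum>b\<in>Basis. br x (br z (br y b)) \<bullet> b)"
    by (rule trace_commute[OF bilinear_linear(1)[OF bil] lin])
  then show ?thesis
    by (simp add: killing_form_def jac inner_diff_left sum_subtractf bilinear_rsub[OF bil])
qed

text \<open>
  An automorphism conjugates \<open>ad x\<close> into \<open>ad (\<omega> x)\<close>, and conjugation preserves traces.
\<close>

lemma killing_form_automorphism:
  assumes bil: "bilinear br" and lin: "linear \<omega>"
    and hom: "\<And>x y. \<omega> (br x y) = br (\<omega> x) (\<omega> y)" and inv: "\<And>x. \<omega> (\<omega> x) = x"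
  shows "killing_form br (\<omega> x) (\<omega> y) = killing_form br x y"
proof -
  have lin': "linear (\<lambda>u. br x (br y (\<omega> u)))"
    using linear_compose[OF linear_compose[OF lin bilinear_linear(1)[OF bil, of y]]
        bilinear_linear(1)[OF bil, of x]] by (simp add: o_def)
  have "killing_form br (\<omega> x) (\<omega> y) = (\<Sum>b\<in>Basis. \<omega> (br x (br y (\<omega> b))) \<bullet> b)"
    by (simp add: killing_form_def hom inv)
  also have "\<dots> = (\<Sum>b\<in>Basis. br x (br y (\<omega> (\<omega> b))) \<bullet> b)"
    by (rule trace_commute[OF lin lin'])
  finally show ?thesis by (simp add: inv killing_form_def)
qed

section \<open>Split simple Lie algebras and their Cartan--Chevalley involution\<close>

text \<open>
  By the Jacobi identity a bracket of two eigenvectors of \<open>ad t\<close> is again an eigenvector, with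
  the sum of the eigenvalues; hence the span of the eigenvectors is a subalgebra, and it contains the generators.
\<close>

lemma generated_by_eigenvectors:
  assumes lie: "lie_bracket br" and gen: "lie_generates br G"
    and G: "\<And>g. g \<in> G \<Longrightarrow> \<exists>r. br t g = r *\<^sub>R g"
  shows "span {v. \<exists>r. br t v = r *\<^sub>R v} = UNIV"
proof -
  note bil = lie_bracket_properties(1)[OF lie]
  let ?E = "{v. \<exists>r. br t v = r *\<^sub>R v}"
  have EE: "br v w \<in> span ?E" if "v \<in> ?E" "w \<in> ?E" for v w
  proof -
    from that obtain r s where "br t v = r *\<^sub>R v" "br t w = s *\<^sub>R w" by blast
    then have "br t (br v w) = (r + s) *\<^sub>R br v w"
      by (simp add: lie_bracket_properties(3)[OF lie, of t] bilinear_lmul[OF bil]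
          bilinear_rmul[OF bil] scaleR_add_left)
    then show ?thesis by (intro span_base) blast
  qed
  have E1: "br v y \<in> span ?E" if "v \<in> ?E" "y \<in> span ?E" for v y
    using that(2)
  proof (rule span_induct)
    show "subspace {y. br v y \<in> span ?E}"
      by (auto simp: subspace_def bilinear_rzero[OF bil] bilinear_radd[OF bil]
          bilinear_rmul[OF bil] span_zero intro: span_add span_scale)
  qed (use EE that(1) in blast)
  have "br x y \<in> span ?E" if "x \<in> span ?E" "y \<in> span ?E" for x y
    using that(1)
  proof (rule span_induct)
    show "subspace {x. br x y \<in> span ?E}"
      by (auto simp: subspace_def bilinear_lzero[OF bil] bilinear_ladd[OF bil]
          bilinear_lmul[OF bil] span_zero intro: span_add span_scale)
  qed (use E1 that(2) in blast)
  moreover have "G \<subseteq> span ?E" using G by (auto intro: span_base)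
  ultimately show ?thesis
    using gen[unfolded lie_generates_def, rule_format, of "span ?E"] subspace_span by blast
qed

text \<open>
  The radical of the Killing form is an ideal, so in a simple algebra it is zero or everything. The
  second case is excluded by \<open>h i\<close>: its adjoint map is diagonalizable over the reals and does not
  vanish, so that its square has positive trace.
\<close>

lemma killing_form_nondegenerate:
  assumes split: "split_simple_lie_algebra br A e f h" and "e i \<noteq> 0"
    and deg: "\<And>y. killing_form br x y = 0"
  shows "x = 0"
proof -
  have simple: "simple_lie_bracket br" and Aii: "A i i = 2"
    and he: "\<And>i j. br (h i) (e j) = real_of_int (A i j) *\<^sub>R e j"
    and hf: "\<And>i j. br (h i) (f j) = - (real_of_int (A i j) *\<^sub>R f j)"
    and gen: "lie_generates br (range e \<union> range f)"
    using split by (auto simp: split_simple_lie_algebra_def finite_type_cartan_matrix_def)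
  have lie: "lie_bracket br" using simple by (simp add: simple_lie_bracket_def)
  note bil = lie_bracket_properties(1)[OF lie]
  note kbil = killing_form_bilinear[OF bil]
  let ?R = "{x. \<forall>y. killing_form br x y = 0}"
  have "subspace ?R"
    by (auto simp: subspace_def bilinear_lzero[OF kbil] bilinear_ladd[OF kbil] bilinear_lmul[OF kbil])
  moreover have "br z x \<in> ?R" if "x \<in> ?R" for z x
    using that lie_bracket_properties(2)[OF lie, of z x]
    by (simp add: bilinear_lneg[OF kbil] killing_form_invariant[OF lie])
  ultimately have "?R = {0} \<or> ?R = UNIV"
    using simple by (simp add: simple_lie_bracket_def)
  moreover have "killing_form br (h i) (h i) > 0"
    unfolding killing_form_def
  proof (rule trace_square_pos[of "br (h i)" "e i"])
    show "span {v. \<exists>r. br (h i) v = r *\<^sub>R v} = UNIV"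
    proof (rule generated_by_eigenvectors[OF lie gen])
      fix g assume "g \<in> range e \<union> range f"
      then show "\<exists>r. br (h i) g = r *\<^sub>R g"
        by (auto simp: he hf simp flip: scaleR_minus_left)
    qed
  qed (use assms(2) Aii in \<open>auto simp: he bilinear_linear[OF bil]\<close>)
  ultimately have "?R = {0}" by (metis (mono_tags, lifting) UNIV_I less_irrefl mem_Collect_eq)
  then show ?thesis using deg by blast
qed

lemma chevalley_involution_involutive:
  assumes lie: "bilinear br" and gen: "lie_generates br (range e \<union> range f)"
    and cci: "cartan_chevalley_involution br e f h \<omega>"
  shows "\<omega> (\<omega> x) = x"
proof -
  have lin: "linear \<omega>" and hom: "\<And>x y. \<omega> (br x y) = br (\<omega> x) (\<omega> y)"
    and "\<And>i. \<omega> (e i) = - f i" "\<And>i. \<omega> (f i) = - e i"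
    using cci by (auto simp: cartan_chevalley_involution_def)
  let ?S = "{x. \<omega> (\<omega> x) = x}"
  have "subspace ?S"
    by (auto simp: subspace_def linear_0[OF lin] linear_add[OF lin] linear_scale[OF lin])
  moreover have "range e \<union> range f \<subseteq> ?S"
    by (auto simp: \<open>\<And>i. \<omega> (e i) = - f i\<close> \<open>\<And>i. \<omega> (f i) = - e i\<close> linear_neg[OF lin])
  moreover have "\<forall>x\<in>?S. \<forall>y\<in>?S. br x y \<in> ?S" by (simp add: hom)
  ultimately have "?S = UNIV" using gen unfolding lie_generates_def by blast
  then show ?thesis by blast
qed

text \<open>
  The commutator that drives the counterexample: \<open>e i - f i\<close> is fixed by \<open>\<omega>\<close>, \<open>h i\<close> is negated,
  and \<open>[e i - f i, h i] = -2 (e i + f i)\<close>.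
\<close>

lemma noncommuting_even_odd:
  assumes split: "split_simple_lie_algebra br A e f h"
    and cci: "cartan_chevalley_involution br e f h \<omega>"
  obtains i where "e i \<noteq> 0" "\<omega> (e i - f i) = e i - f i" "br (e i - f i) (h i) \<noteq> 0"
proof -
  have simple: "simple_lie_bracket br" and Aii: "\<And>i. A i i = 2"
    and he: "\<And>i j. br (h i) (e j) = real_of_int (A i j) *\<^sub>R e j"
    and hf: "\<And>i j. br (h i) (f j) = - (real_of_int (A i j) *\<^sub>R f j)"
    and gen: "lie_generates br (range e \<union> range f)"
    using split by (auto simp: split_simple_lie_algebra_def finite_type_cartan_matrix_def)
  have lin: "linear \<omega>" and we: "\<And>i. \<omega> (e i) = - f i" "\<And>i. \<omega> (f i) = - e i"
    using cci by (auto simp: cartan_chevalley_involution_def)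
  have lie: "lie_bracket br" using simple by (simp add: simple_lie_bracket_def)
  note bil = lie_bracket_properties(1)[OF lie]
  have "\<exists>i. e i \<noteq> 0"
  proof (rule ccontr)
    assume "\<not> ?thesis"
    then have "e i = 0" "f i = 0" for i
      using we(1)[of i] linear_0[OF lin] by auto
    then have "range e \<union> range f \<subseteq> {0}" by auto
    moreover have "\<forall>x\<in>{0}. \<forall>y\<in>{0}. br x y \<in> {0}" by (simp add: bilinear_lzero[OF bil])
    ultimately have "{0} = (UNIV :: 'a set)"
      using gen subspace_single_0 unfolding lie_generates_def by blast
    then have "br x y = 0" for x y by blast
    with simple show False by (simp add: simple_lie_bracket_def)
  qed
  then obtain i where i: "e i \<noteq> 0" by blast
  have "br (e i - f i) (h i) = - br (h i) (e i - f i)" by (rule lie_bracket_properties(2)[OF lie])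
  also have "\<dots> = - 2 *\<^sub>R (e i + f i)"
    by (simp add: bilinear_rsub[OF bil] he hf Aii scaleR_add_right)
  finally have br: "br (e i - f i) (h i) = - 2 *\<^sub>R (e i + f i)" .
  have "br (e i - f i) (h i) \<noteq> 0"
  proof
    assume "br (e i - f i) (h i) = 0"
    with br have ef: "f i = - e i" by (simp add: add_eq_0_iff)
    have "2 *\<^sub>R e i = - (2 *\<^sub>R f i)" by (simp add: ef)
    also have "\<dots> = br (h i) (f i)" by (simp add: hf Aii)
    also have "\<dots> = - (2 *\<^sub>R e i)" by (simp add: ef bilinear_rneg[OF bil] he Aii)
    finally have "(2 + 2) *\<^sub>R e i = 0" by (simp only: scaleR_add_left add_eq_0_iff)
    with i show False by simp
  qed
  moreover have "\<omega> (e i - f i) = e i - f i" by (simp add: linear_diff[OF lin] we)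
  ultimately show thesis using that i by blast
qed

section \<open>The fixed algebra as a space of Laurent polynomials\<close>

lemma lookup_scaleR: "Poly_Mapping.lookup (r *\<^sub>R P) n = r *\<^sub>R Poly_Mapping.lookup P n"
  by (simp add: scaleR_poly_mapping.rep_eq)

lemma lookup_loop_bracket:
  assumes bil: "bilinear br" and A: "finite A" "Poly_Mapping.keys P \<subseteq> A"
  shows "Poly_Mapping.lookup (loop_bracket br P Q) k =
    (\<Sum>m\<in>A. br (Poly_Mapping.lookup P m) (Poly_Mapping.lookup Q (k - m)))"
proof -
  have inner: "(\<Sum>n\<in>Poly_Mapping.keys Q. br x (Poly_Mapping.lookup Q n) when m + n = k) =
      br x (Poly_Mapping.lookup Q (k - m))" for m x
  proof (cases "k - m \<in> Poly_Mapping.keys Q")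
    case True
    have "(\<Sum>n\<in>Poly_Mapping.keys Q. br x (Poly_Mapping.lookup Q n) when m + n = k) =
        (\<Sum>n\<in>{k - m}. br x (Poly_Mapping.lookup Q n) when m + n = k)"
      by (rule sum.mono_neutral_right) (use True in auto)
    then show ?thesis by simp
  next
    case False
    then have "(\<Sum>n\<in>Poly_Mapping.keys Q. br x (Poly_Mapping.lookup Q n) when m + n = k) = 0"
      by (intro sum.neutral) (auto simp: when_def)
    with False show ?thesis by (simp add: in_keys_iff bilinear_rzero[OF bil])
  qed
  have "Poly_Mapping.lookup (loop_bracket br P Q) k =
      (\<Sum>m\<in>Poly_Mapping.keys P. br (Poly_Mapping.lookup P m) (Poly_Mapping.lookup Q (k - m)))"
    by (simp add: loop_bracket_def lookup_sum lookup_single inner)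
  also have "\<dots> = (\<Sum>m\<in>A. br (Poly_Mapping.lookup P m) (Poly_Mapping.lookup Q (k - m)))"
    by (rule sum.mono_neutral_left) (use A in \<open>auto simp: in_keys_iff bilinear_lzero[OF bil]\<close>)
  finally show ?thesis .
qed

lemma lookup_loop_derivation:
  "Poly_Mapping.lookup (loop_derivation P) n = real_of_int n *\<^sub>R Poly_Mapping.lookup P n"
  by (cases "n \<in> Poly_Mapping.keys P")
     (auto simp: loop_derivation_def lookup_sum lookup_single when_def in_keys_iff)

lemma loop_form_eq:
  assumes bil: "bilinear br" and A: "finite A" "Poly_Mapping.keys P \<subseteq> A"
  shows "loop_form br c P Q =
    (\<Sum>n\<in>A. c * killing_form br (Poly_Mapping.lookup P n) (Poly_Mapping.lookup Q (- n)))"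
  unfolding loop_form_def
  by (rule sum.mono_neutral_left)
     (use A in \<open>auto simp: in_keys_iff bilinear_lzero[OF killing_form_bilinear[OF bil]]\<close>)

lemma sum_int_reflect:
  fixes F :: "int \<Rightarrow> 'b::comm_monoid_add"
  assumes "\<And>n. - n \<in> A \<longleftrightarrow> n \<in> A"
  shows "(\<Sum>n\<in>A. F (- n)) = (\<Sum>n\<in>A. F n)"
  by (rule sum.reindex_bij_witness[of _ uminus uminus]) (use assms in auto)

text \<open>
  The data of the split simple Lie algebra enter the analysis through an involutive automorphism and
  the nondegeneracy of the Killing form.
\<close>

locale loop_completion =
  fixes br :: "'a::euclidean_space \<Rightarrow> 'a \<Rightarrow> 'a"
    and \<omega> :: "'a \<Rightarrow> 'a"
    and c :: real
    and \<iota> :: "'a affine \<Rightarrow> 'h::{real_inner, complete_space}"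
  assumes lie: "lie_bracket br"
    and omega_linear: "linear \<omega>"
    and omega_br: "\<omega> (br x y) = br (\<omega> x) (\<omega> y)"
    and omega_omega: "\<omega> (\<omega> x) = x"
    and nondegenerate: "(\<And>y. killing_form br x y = 0) \<Longrightarrow> x = 0"
    and c_pos: "c > 0"
    and completion: "hilbert_completion (maximal_compact \<omega>) (\<lambda>x y. - affine_form br c x y) \<iota>"
begin

abbreviation "K \<equiv> maximal_compact \<omega>"
abbreviation "brK \<equiv> affine_bracket br c"

definition coeff_inner :: "'a \<Rightarrow> 'a \<Rightarrow> real" where
  "coeff_inner x y = - c * killing_form br x (\<omega> y)"

lemmas bil = lie_bracket_properties(1)[OF lie]
lemmas kbil = killing_form_bilinear[OF bil]

lemma K_iff:
  "(P, a, b) \<in> K \<longleftrightarrow>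
     a = 0 \<and> b = 0 \<and> (\<forall>n. Poly_Mapping.lookup P (- n) = \<omega> (Poly_Mapping.lookup P n))"
proof -
  have lk: "Poly_Mapping.lookup (\<Sum>n\<in>Poly_Mapping.keys P.
      Poly_Mapping.single (- n) (\<omega> (Poly_Mapping.lookup P n))) k = \<omega> (Poly_Mapping.lookup P (- k))" for k
  proof -
    have "(- n = k) = (n = - k)" for n by auto
    then show ?thesis
      by (cases "- k \<in> Poly_Mapping.keys P")
         (auto simp: lookup_sum lookup_single when_def in_keys_iff linear_0[OF omega_linear])
  qed
  have "affine_involution \<omega> (P, a, b) = (P, a, b) \<longleftrightarrow>
      a = 0 \<and> b = 0 \<and> (\<forall>n. \<omega> (Poly_Mapping.lookup P (- n)) = Poly_Mapping.lookup P n)"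
    by (auto simp: poly_mapping_eq_iff fun_eq_iff lk)
  moreover have "(\<forall>n. \<omega> (Poly_Mapping.lookup P (- n)) = Poly_Mapping.lookup P n) \<longleftrightarrow>
      (\<forall>n. Poly_Mapping.lookup P (- n) = \<omega> (Poly_Mapping.lookup P n))"
    by (metis omega_omega)
  ultimately show ?thesis by (simp add: maximal_compact_def)
qed

lemma K_cases:
  assumes "u \<in> K"
  obtains P where "u = (P, 0, 0)" "\<And>n. Poly_Mapping.lookup P (- n) = \<omega> (Poly_Mapping.lookup P n)"
  using assms by (cases u) (auto simp: K_iff)

lemma omega_eq_0_iff: "\<omega> x = 0 \<longleftrightarrow> x = 0"
  by (metis omega_omega linear_0[OF omega_linear])

lemma keys_symmetric: "(P, 0, 0) \<in> K \<Longrightarrow> - n \<in> Poly_Mapping.keys P \<longleftrightarrow> n \<in> Poly_Mapping.keys P"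
  by (simp add: K_iff in_keys_iff omega_eq_0_iff)

lemma subspace_K: "subspace K"
proof (rule subspaceI)
  show "0 \<in> K" by (simp add: zero_prod_def K_iff linear_0[OF omega_linear])
next
  fix u v assume "u \<in> K" "v \<in> K"
  then show "u + v \<in> K"
    by (cases u; cases v) (simp add: K_iff lookup_add linear_add[OF omega_linear])
next
  fix r u assume "u \<in> K"
  then show "r *\<^sub>R u \<in> K"
    by (cases u) (simp add: K_iff lookup_scaleR linear_scale[OF omega_linear])
qed

lemma iota_diff: "u \<in> K \<Longrightarrow> v \<in> K \<Longrightarrow> \<iota> (u - v) = \<iota> u - \<iota> v"
proof -
  assume uv: "u \<in> K" "v \<in> K"
  then have "\<iota> (u + (- 1) *\<^sub>R v) = \<iota> u + \<iota> ((- 1) *\<^sub>R v)"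
    using completion subspace_scale[OF subspace_K, of v "- 1"]
    unfolding hilbert_completion_def by blast
  moreover have "\<iota> ((- 1) *\<^sub>R v) = (- 1) *\<^sub>R \<iota> v"
    using completion uv unfolding hilbert_completion_def by blast
  ultimately show ?thesis by simp
qed

text \<open>
  The central cocycle vanishes on the fixed algebra, because its summands at \<open>n\<close> and \<open>-n\<close> cancel
  by invariance of the Killing form under \<open>\<omega>\<close>. The fixed algebra is therefore a subalgebra of the
  loop algebra.
\<close>

lemma bracket_K:
  assumes P: "(P, 0, 0) \<in> K" and Q: "(Q, 0, 0) \<in> K"
  shows "brK (P, 0, 0) (Q, 0, 0) = (loop_bracket br P Q, 0, 0)"
    and "(loop_bracket br P Q, 0, 0) \<in> K"
proof -
  let ?A = "Poly_Mapping.keys P"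
  let ?F = "\<lambda>n. c * killing_form br (real_of_int n *\<^sub>R Poly_Mapping.lookup P n) (Poly_Mapping.lookup Q (- n))"
  have "Poly_Mapping.keys (loop_derivation P) \<subseteq> ?A"
    by (auto simp: in_keys_iff lookup_loop_derivation)
  then have "loop_form br c (loop_derivation P) Q = (\<Sum>n\<in>?A. ?F n)"
    by (simp add: loop_form_eq[OF bil finite_keys] lookup_loop_derivation)
  also have "\<dots> = (\<Sum>n\<in>?A. ?F (- n))"
    by (rule sum_int_reflect[symmetric]) (rule keys_symmetric[OF P])
  also have "\<dots> = (\<Sum>n\<in>?A. - ?F n)"
  proof (intro sum.cong refl)
    fix n
    have "killing_form br (\<omega> (Poly_Mapping.lookup P n)) (\<omega> (Poly_Mapping.lookup Q (- n))) =
        killing_form br (Poly_Mapping.lookup P n) (Poly_Mapping.lookup Q (- n))"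
      by (rule killing_form_automorphism[OF bil omega_linear omega_br omega_omega])
    moreover have "Poly_Mapping.lookup Q (- (- n)) = \<omega> (Poly_Mapping.lookup Q (- n))"
      using Q unfolding K_iff by blast
    moreover have "Poly_Mapping.lookup P (- n) = \<omega> (Poly_Mapping.lookup P n)"
      using P unfolding K_iff by blast
    ultimately show "?F (- n) = - ?F n"
      by (simp add: bilinear_lmul[OF kbil] bilinear_lneg[OF kbil])
  qed
  also have "\<dots> = - (\<Sum>n\<in>?A. ?F n)" by (rule sum_negf)
  finally have "loop_form br c (loop_derivation P) Q = 0"
    by (simp add: \<open>loop_form br c (loop_derivation P) Q = (\<Sum>n\<in>?A. ?F n)\<close>)
  then show "brK (P, 0, 0) (Q, 0, 0) = (loop_bracket br P Q, 0, 0)" by simp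
  have "Poly_Mapping.lookup (loop_bracket br P Q) (- k) = \<omega> (Poly_Mapping.lookup (loop_bracket br P Q) k)" for k
  proof -
    have "Poly_Mapping.lookup (loop_bracket br P Q) (- k) =
        (\<Sum>m\<in>?A. br (Poly_Mapping.lookup P (- m)) (Poly_Mapping.lookup Q (- k - - m)))"
      unfolding lookup_loop_bracket[OF bil finite_keys subset_refl]
      by (rule sum_int_reflect[symmetric]) (rule keys_symmetric[OF P])
    also have "\<dots> = (\<Sum>m\<in>?A. \<omega> (br (Poly_Mapping.lookup P m) (Poly_Mapping.lookup Q (k - m))))"
    proof (intro sum.cong refl)
      fix m
      have "Poly_Mapping.lookup Q (- (k - m)) = \<omega> (Poly_Mapping.lookup Q (k - m))"
        using Q unfolding K_iff by blast
      moreover have "- k - - m = - (k - m)" by simp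
      moreover have "Poly_Mapping.lookup P (- m) = \<omega> (Poly_Mapping.lookup P m)"
        using P unfolding K_iff by blast
      ultimately show "br (Poly_Mapping.lookup P (- m)) (Poly_Mapping.lookup Q (- k - - m)) =
          \<omega> (br (Poly_Mapping.lookup P m) (Poly_Mapping.lookup Q (k - m)))"
        by (simp only: omega_br)
    qed
    finally show ?thesis
      by (simp add: lookup_loop_bracket[OF bil finite_keys subset_refl] linear_sum[OF omega_linear])
  qed
  then show "(loop_bracket br P Q, 0, 0) \<in> K" by (simp add: K_iff)
qed

lemma bracket_closed:
  assumes "u \<in> K" "v \<in> K"
  shows "brK u v \<in> K"
proof -
  obtain P where u: "u = (P, 0, 0)" using assms(1) by (rule K_cases)
  obtain Q where v: "v = (Q, 0, 0)" using assms(2) by (rule K_cases)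
  show ?thesis
    using bracket_K[OF assms[unfolded u v]] unfolding u v by (simp only:)
qed

lemma bracket_diff:
  assumes "u \<in> K" "u' \<in> K" "v \<in> K"
  shows "brK (u - u') v = brK u v - brK u' v" "brK v (u - u') = brK v u - brK v u'"
proof -
  obtain P where "u = (P, 0, 0)" using assms(1) by (rule K_cases)
  moreover obtain P' where "u' = (P', 0, 0)" using assms(2) by (rule K_cases)
  moreover obtain Q where "v = (Q, 0, 0)" using assms(3) by (rule K_cases)
  ultimately have eq: "u = (P, 0, 0)" "u' = (P', 0, 0)" "v = (Q, 0, 0)" by simp_all
  have d: "u - u' = (P - P', 0, 0)" by (simp add: eq zero_prod_def)
  have mem: "(P, 0, 0) \<in> K" "(P', 0, 0) \<in> K" "(Q, 0, 0) \<in> K" "(P - P', 0, 0) \<in> K"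
    using assms subspace_diff[OF subspace_K assms(1,2)] by (simp_all add: eq zero_prod_def)
  let ?A = "Poly_Mapping.keys P \<union> Poly_Mapping.keys P' \<union> Poly_Mapping.keys (P - P')"
  have A: "finite ?A" by simp
  have "loop_bracket br (P - P') Q = loop_bracket br P Q - loop_bracket br P' Q"
  proof (rule poly_mapping_eqI)
    fix k
    show "Poly_Mapping.lookup (loop_bracket br (P - P') Q) k =
        Poly_Mapping.lookup (loop_bracket br P Q - loop_bracket br P' Q) k"
      unfolding lookup_minus
      by (subst (1 2 3) lookup_loop_bracket[OF bil A])
         (auto simp: lookup_minus bilinear_lsub[OF bil] sum_subtractf)
  qed
  then show "brK (u - u') v = brK u v - brK u' v"
    unfolding d unfolding eq bracket_K(1)[OF mem(4,3)] bracket_K(1)[OF mem(1,3)] bracket_K(1)[OF mem(2,3)]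
    by (simp add: zero_prod_def)
  have "loop_bracket br Q (P - P') = loop_bracket br Q P - loop_bracket br Q P'"
    by (rule poly_mapping_eqI)
       (simp add: lookup_minus lookup_loop_bracket[OF bil finite_keys subset_refl]
          bilinear_rsub[OF bil] sum_subtractf)
  then show "brK v (u - u') = brK v u - brK v u'"
    unfolding d unfolding eq bracket_K(1)[OF mem(3,4)] bracket_K(1)[OF mem(3,1)] bracket_K(1)[OF mem(3,2)]
    by (simp add: zero_prod_def)
qed

lemma inner_K:
  assumes "(P, 0, 0) \<in> K" "(Q, 0, 0) \<in> K" and A: "finite A" "Poly_Mapping.keys P \<subseteq> A"
  shows "\<iota> (P, 0, 0) \<bullet> \<iota> (Q, 0, 0) = (\<Sum>n\<in>A. coeff_inner (Poly_Mapping.lookup P n) (Poly_Mapping.lookup Q n))"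
proof -
  have "Poly_Mapping.lookup Q (- n) = \<omega> (Poly_Mapping.lookup Q n)" for n
    using assms(2) by (simp add: K_iff)
  moreover have "\<iota> (P, 0, 0) \<bullet> \<iota> (Q, 0, 0) = - affine_form br c (P, 0, 0) (Q, 0, 0)"
    using completion assms(1,2) unfolding hilbert_completion_def by blast
  ultimately show ?thesis
    by (simp add: loop_form_eq[OF bil A] coeff_inner_def sum_negf)
qed

lemma coeff_inner_bilinear: "bilinear coeff_inner"
  unfolding bilinear_def
proof (intro conjI allI linearI)
  fix x y z r
  show "coeff_inner x (y + z) = coeff_inner x y + coeff_inner x z" "coeff_inner (x + y) z = coeff_inner x z + coeff_inner y z"
    by (simp_all add: coeff_inner_def bilinear_ladd[OF kbil] bilinear_radd[OF kbil]
        linear_add[OF omega_linear] distrib_left)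
  show "coeff_inner x (r *\<^sub>R y) = r *\<^sub>R coeff_inner x y" "coeff_inner (r *\<^sub>R x) y = r *\<^sub>R coeff_inner x y"
    by (simp_all add: coeff_inner_def bilinear_lmul[OF kbil] bilinear_rmul[OF kbil] linear_scale[OF omega_linear])
qed

lemma coeff_inner_commute: "coeff_inner x y = coeff_inner y x"
proof -
  have "killing_form br x (\<omega> y) = killing_form br (\<omega> x) (\<omega> (\<omega> y))"
    by (rule killing_form_automorphism[OF bil omega_linear omega_br omega_omega, symmetric])
  then show ?thesis by (simp add: coeff_inner_def omega_omega killing_form_commute[OF bil])
qed

lemma coeff_inner_omega: "coeff_inner (\<omega> x) (\<omega> y) = coeff_inner x y"
  unfolding coeff_inner_def by (simp add: killing_form_automorphism[OF bil omega_linear omega_br omega_omega])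

text \<open>
  The elements \<open>t \<otimes> x + t\<inverse> \<otimes> \<omega> x\<close> lie in the fixed algebra, where the form is an inner product by
  hypothesis, and their square norm is twice this value.
\<close>

lemma coeff_inner_nonneg: "coeff_inner x x \<ge> 0"
proof -
  let ?P = "Poly_Mapping.single (1::int) x + Poly_Mapping.single (- 1) (\<omega> x)"
  have lk: "Poly_Mapping.lookup ?P n = (if n = 1 then x else if n = - 1 then \<omega> x else 0)" for n
    by (auto simp: lookup_add lookup_single when_def)
  have "Poly_Mapping.lookup ?P (- n) = \<omega> (Poly_Mapping.lookup ?P n)" for n
    unfolding lk by (auto simp: omega_omega linear_0[OF omega_linear])
  then have K: "(?P, 0, 0) \<in> K" by (simp add: K_iff)
  have keys: "Poly_Mapping.keys ?P \<subseteq> {1, - 1}" by (auto simp: in_keys_iff lk split: if_splits)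
  have "\<iota> (?P, 0, 0) \<bullet> \<iota> (?P, 0, 0) = 2 * coeff_inner x x"
    by (subst inner_K[OF K K _ keys]) (simp_all only: lk, simp_all add: coeff_inner_omega)
  moreover have "\<iota> (?P, 0, 0) \<bullet> \<iota> (?P, 0, 0) \<ge> 0" by (rule inner_ge_zero)
  ultimately show ?thesis by linarith
qed

text \<open>
  A null vector of a positive semidefinite form is orthogonal to everything, so it lies in the
  radical of the Killing form.
\<close>

lemma coeff_inner_definite:
  assumes "coeff_inner x x = 0" shows "x = 0"
proof (rule nondegenerate)
  fix y
  have "coeff_inner x z = 0" for z
  proof (rule ccontr)
    assume nz: "coeff_inner x z \<noteq> 0"
    have pos: "0 \<le> coeff_inner z z + 2 * t * coeff_inner x z" for t
      using coeff_inner_nonneg[of "t *\<^sub>R x + z"] assms coeff_inner_commute[of x z]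
      by (simp add: bilinear_ladd[OF coeff_inner_bilinear] bilinear_radd[OF coeff_inner_bilinear]
          bilinear_lmul[OF coeff_inner_bilinear] bilinear_rmul[OF coeff_inner_bilinear])
    show False
      using pos[of "- (coeff_inner z z + 1) / (2 * coeff_inner x z)"] nz by (simp add: field_simps)
  qed
  from this[of "\<omega> y"] c_pos show "killing_form br x y = 0" by (simp add: coeff_inner_def omega_omega)
qed

text \<open>
  Compactness of the unit sphere makes the norms of the completion and of the coefficient space
  comparable, so that square summability can be tested with either one.
\<close>

lemma coeff_inner_coercive: obtains \<delta> where "\<delta> > 0" "\<And>x. \<delta> * (norm x)\<^sup>2 \<le> coeff_inner x x"
proof -
  have cont: "continuous_on (sphere 0 1) (\<lambda>x. coeff_inner x x)"
    using coeff_inner_bilinear[unfolded bilinear_conv_bounded_bilinear]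
    by (rule bounded_bilinear.continuous_on) (rule continuous_on_id)+
  have "sphere (0::'a) 1 \<noteq> {}" by simp
  then obtain s where s: "s \<in> sphere 0 1" "\<And>x. x \<in> sphere 0 1 \<Longrightarrow> coeff_inner s s \<le> coeff_inner x x"
    using continuous_attains_inf[OF compact_sphere _ cont] by blast
  have "coeff_inner s s > 0"
    using s(1) coeff_inner_definite[of s] coeff_inner_nonneg[of s] by fastforce
  moreover have "coeff_inner s s * (norm x)\<^sup>2 \<le> coeff_inner x x" for x
  proof (cases "x = 0")
    case False
    have "coeff_inner s s \<le> coeff_inner ((1 / norm x) *\<^sub>R x) ((1 / norm x) *\<^sub>R x)"
      by (rule s(2)) (use False in simp)
    with False show ?thesis
      by (simp add: bilinear_lmul[OF coeff_inner_bilinear] bilinear_rmul[OF coeff_inner_bilinear] field_simps power2_eq_square)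
  qed (simp add: bilinear_lzero[OF coeff_inner_bilinear])
  ultimately show thesis by (rule that)
qed

section \<open>Boundedness of commutator pairings\<close>

text \<open>
  Although the bracket itself is unbounded, each of its coefficients is a convolution of two
  square-summable sequences, hence bounded by Cauchy--Schwarz, and a test vector sees only finitely
  many coefficients.
\<close>

lemma bracket_pairing_bounded:
  assumes w: "w \<in> K"
  obtains C where "\<And>u v. u \<in> K \<Longrightarrow> v \<in> K \<Longrightarrow> \<bar>\<iota> (brK u v) \<bullet> \<iota> w\<bar> \<le> C * norm (\<iota> u) * norm (\<iota> v)"
proof -
  obtain \<delta> where \<delta>: "\<delta> > 0" "\<And>x. \<delta> * (norm x)\<^sup>2 \<le> coeff_inner x x" by (rule coeff_inner_coercive) blast
  obtain L where L: "\<And>x y. norm (br x y) \<le> norm x * norm y * L" "L > 0"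
    using bounded_bilinear.pos_bounded[OF bil[unfolded bilinear_conv_bounded_bilinear]] by blast
  obtain M where M: "\<And>x y. norm (coeff_inner x y) \<le> norm x * norm y * M" "M > 0"
    using bounded_bilinear.pos_bounded[OF coeff_inner_bilinear[unfolded bilinear_conv_bounded_bilinear]] by blast
  obtain W where W: "w = (W, 0, 0)" using w by (rule K_cases)
  have coeffs: "L2_set (\<lambda>n. norm (Poly_Mapping.lookup P n)) A \<le> norm (\<iota> (P, 0, 0)) / sqrt \<delta>"
    if P: "(P, 0, 0) \<in> K" and A: "finite A" for P A
  proof -
    have "\<delta> * (\<Sum>n\<in>A. (norm (Poly_Mapping.lookup P n))\<^sup>2)
        \<le> \<delta> * (\<Sum>n\<in>A \<union> Poly_Mapping.keys P. (norm (Poly_Mapping.lookup P n))\<^sup>2)"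
      using \<delta>(1) A by (intro mult_left_mono sum_mono2) auto
    also have "\<dots> \<le> (\<Sum>n\<in>A \<union> Poly_Mapping.keys P. coeff_inner (Poly_Mapping.lookup P n) (Poly_Mapping.lookup P n))"
      unfolding sum_distrib_left by (intro sum_mono \<delta>(2))
    also have "\<dots> = (norm (\<iota> (P, 0, 0)))\<^sup>2"
      using A by (simp add: power2_norm_eq_inner inner_K[OF P P, of "A \<union> Poly_Mapping.keys P"])
    finally have "(\<Sum>n\<in>A. (norm (Poly_Mapping.lookup P n))\<^sup>2) \<le> (norm (\<iota> (P, 0, 0)) / sqrt \<delta>)\<^sup>2"
      using \<delta>(1) by (simp add: power_divide field_simps)
    then show ?thesis unfolding L2_set_def using \<delta>(1) by (intro real_le_lsqrt) auto
  qed
  define C where "C = (\<Sum>n\<in>Poly_Mapping.keys W. norm (Poly_Mapping.lookup W n) * M * L / \<delta>)"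
  have "\<bar>\<iota> (brK u v) \<bullet> \<iota> w\<bar> \<le> C * norm (\<iota> u) * norm (\<iota> v)" if uv: "u \<in> K" "v \<in> K" for u v
  proof -
    obtain P where u: "u = (P, 0, 0)" using uv(1) by (rule K_cases)
    obtain Q where v: "v = (Q, 0, 0)" using uv(2) by (rule K_cases)
    have PQ: "(P, 0, 0) \<in> K" "(Q, 0, 0) \<in> K" using uv by (simp_all add: u v)
    let ?R = "loop_bracket br P Q" and ?U = "norm (\<iota> u)" and ?V = "norm (\<iota> v)"
    have R: "norm (Poly_Mapping.lookup ?R n) \<le> L / \<delta> * ?U * ?V" for n
    proof -
      let ?A = "Poly_Mapping.keys P"
      have "norm (Poly_Mapping.lookup ?R n) \<le>
          (\<Sum>m\<in>?A. norm (br (Poly_Mapping.lookup P m) (Poly_Mapping.lookup Q (n - m))))"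
        unfolding lookup_loop_bracket[OF bil finite_keys subset_refl] by (rule norm_sum)
      also have "\<dots> \<le> (\<Sum>m\<in>?A. L * (\<bar>norm (Poly_Mapping.lookup P m)\<bar> * \<bar>norm (Poly_Mapping.lookup Q (n - m))\<bar>))"
        by (rule sum_mono) (use L(1) in \<open>simp add: mult_ac\<close>)
      also have "\<dots> \<le> L * (L2_set (\<lambda>m. norm (Poly_Mapping.lookup P m)) ?A
          * L2_set (\<lambda>m. norm (Poly_Mapping.lookup Q (n - m))) ?A)"
        unfolding sum_distrib_left[symmetric] using L(2) by (intro mult_left_mono L2_set_mult_ineq) auto
      also have "L2_set (\<lambda>m. norm (Poly_Mapping.lookup Q (n - m))) ?A =
          L2_set (\<lambda>m. norm (Poly_Mapping.lookup Q m)) ((-) n ` ?A)"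
        unfolding L2_set_def by (subst sum.reindex) (auto simp: inj_on_def)
      also have "L * (L2_set (\<lambda>m. norm (Poly_Mapping.lookup P m)) ?A * \<dots>)
          \<le> L * ((?U / sqrt \<delta>) * (?V / sqrt \<delta>))"
        unfolding u v using L(2) \<delta>(1) by (intro mult_left_mono mult_mono coeffs PQ) auto
      also have "\<dots> = L / \<delta> * ?U * ?V" using \<delta>(1) by (simp add: field_simps)
      finally show ?thesis .
    qed
    have "\<iota> (brK u v) \<bullet> \<iota> w = \<iota> w \<bullet> \<iota> (?R, 0, 0)"
      by (simp only: u v bracket_K(1)[OF PQ] inner_commute)
    also have "\<dots> = (\<Sum>n\<in>Poly_Mapping.keys W. coeff_inner (Poly_Mapping.lookup W n) (Poly_Mapping.lookup ?R n))"
      unfolding W by (rule inner_K) (use w bracket_K(2)[OF PQ] in \<open>auto simp: W\<close>)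
    also have "\<bar>\<dots>\<bar> \<le> (\<Sum>n\<in>Poly_Mapping.keys W. \<bar>coeff_inner (Poly_Mapping.lookup W n) (Poly_Mapping.lookup ?R n)\<bar>)"
      by (rule sum_abs)
    also have "\<dots> \<le> (\<Sum>n\<in>Poly_Mapping.keys W. norm (Poly_Mapping.lookup W n) * M * L / \<delta> * ?U * ?V)"
    proof (rule sum_mono)
      fix n
      have "\<bar>coeff_inner (Poly_Mapping.lookup W n) (Poly_Mapping.lookup ?R n)\<bar>
          \<le> norm (Poly_Mapping.lookup W n) * norm (Poly_Mapping.lookup ?R n) * M"
        using M(1) by simp
      also have "\<dots> \<le> norm (Poly_Mapping.lookup W n) * (L / \<delta> * ?U * ?V) * M"
        using M(2) by (intro mult_right_mono mult_left_mono R) auto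
      finally show "\<bar>coeff_inner (Poly_Mapping.lookup W n) (Poly_Mapping.lookup ?R n)\<bar>
          \<le> norm (Poly_Mapping.lookup W n) * M * L / \<delta> * ?U * ?V" by (simp add: mult_ac)
    qed
    also have "\<dots> = C * ?U * ?V" by (simp add: C_def sum_distrib_right)
    finally show ?thesis .
  qed
  then show thesis by (rule that)
qed

text \<open>
  Consequently a completed commutator can be computed from any approximations, in particular from
  truncations of Laurent series.
\<close>

lemma commutator_pairing_independent:
  assumes u: "\<And>n. u n \<in> K" "(\<lambda>n. \<iota> (u n)) \<longlonglongrightarrow> x" and u': "\<And>n. u' n \<in> K" "(\<lambda>n. \<iota> (u' n)) \<longlonglongrightarrow> x"
    and v: "\<And>n. v n \<in> K" "(\<lambda>n. \<iota> (v n)) \<longlonglongrightarrow> y" and v': "\<And>n. v' n \<in> K" "(\<lambda>n. \<iota> (v' n)) \<longlonglongrightarrow> y"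
    and w: "w \<in> K"
  shows "(\<lambda>n. \<iota> (brK (u n) (v n)) \<bullet> \<iota> w - \<iota> (brK (u' n) (v' n)) \<bullet> \<iota> w) \<longlonglongrightarrow> 0"
proof -
  obtain C where C: "\<And>u v. u \<in> K \<Longrightarrow> v \<in> K \<Longrightarrow> \<bar>\<iota> (brK u v) \<bullet> \<iota> w\<bar> \<le> C * norm (\<iota> u) * norm (\<iota> v)"
    using w by (rule bracket_pairing_bounded) blast
  let ?b = "\<lambda>n. C * norm (\<iota> (u n) - \<iota> (u' n)) * norm (\<iota> (v n))
    + C * norm (\<iota> (u' n)) * norm (\<iota> (v n) - \<iota> (v' n))"
  show ?thesis
  proof (rule Lim_null_comparison)
    show "\<forall>\<^sub>F n in sequentially.
        norm (\<iota> (brK (u n) (v n)) \<bullet> \<iota> w - \<iota> (brK (u' n) (v' n)) \<bullet> \<iota> w) \<le> ?b n"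
    proof (rule always_eventually, rule allI)
      fix n
      note mem = u(1)[of n] u'(1)[of n] v(1)[of n] v'(1)[of n]
      have "\<iota> (brK (u n) (v n)) \<bullet> \<iota> w - \<iota> (brK (u' n) (v' n)) \<bullet> \<iota> w =
          \<iota> (brK (u n - u' n) (v n)) \<bullet> \<iota> w + \<iota> (brK (u' n) (v n - v' n)) \<bullet> \<iota> w"
        by (simp add: bracket_diff[OF mem(1,2,3)] bracket_diff[OF mem(3,4,2)]
            iota_diff bracket_closed mem inner_diff_left)
      moreover have "\<bar>\<iota> (brK (u n - u' n) (v n)) \<bullet> \<iota> w\<bar> \<le> C * norm (\<iota> (u n) - \<iota> (u' n)) * norm (\<iota> (v n))"
        using C[OF subspace_diff[OF subspace_K mem(1,2)] mem(3)] by (simp add: iota_diff mem)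
      moreover have "\<bar>\<iota> (brK (u' n) (v n - v' n)) \<bullet> \<iota> w\<bar> \<le> C * norm (\<iota> (u' n)) * norm (\<iota> (v n) - \<iota> (v' n))"
        using C[OF mem(2) subspace_diff[OF subspace_K mem(3,4)]] by (simp add: iota_diff mem)
      ultimately show "norm (\<iota> (brK (u n) (v n)) \<bullet> \<iota> w - \<iota> (brK (u' n) (v' n)) \<bullet> \<iota> w) \<le> ?b n"
        by simp
    qed
    have "?b \<longlonglongrightarrow> C * norm (x - x) * norm y + C * norm x * norm (y - y)"
      by (intro tendsto_intros u u' v v')
    then show "?b \<longlonglongrightarrow> 0" by simp
  qed
qed

text \<open>
  A bounded bracket is continuous, so that it would produce every commutator as a limit in norm.
\<close>

lemma bounded_extension_gives_commutators:
  assumes b: "hilbert_lie_bracket b" and ext: "extends_bracket K brK \<iota> b"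
  shows "completed_commutator K brK \<iota> x y (b x y)"
proof -
  have approx: "\<exists>u. (\<forall>n. u n \<in> K) \<and> (\<lambda>n. \<iota> (u n)) \<longlonglongrightarrow> x" for x
  proof -
    have "closure (\<iota> ` K) = UNIV" using completion unfolding hilbert_completion_def by blast
    then obtain s where s: "\<forall>n. s n \<in> \<iota> ` K" "s \<longlonglongrightarrow> x"
      using closure_sequential[of x "\<iota> ` K"] by blast
    define u where "u n = (SOME k. k \<in> K \<and> s n = \<iota> k)" for n
    have u: "u n \<in> K \<and> s n = \<iota> (u n)" for n
    proof -
      have "\<exists>k. k \<in> K \<and> s n = \<iota> k" using s(1) by blast
      then show ?thesis unfolding u_def by (rule someI_ex)
    qed
    then have "s = (\<lambda>n. \<iota> (u n))" by blast
    with s(2) u show ?thesis by blast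
  qed
  obtain u where u: "\<And>n. u n \<in> K" "(\<lambda>n. \<iota> (u n)) \<longlonglongrightarrow> x" using approx[of x] by blast
  obtain v where v: "\<And>n. v n \<in> K" "(\<lambda>n. \<iota> (v n)) \<longlonglongrightarrow> y" using approx[of y] by blast
  have bilb: "bilinear b" using b by (simp add: hilbert_lie_bracket_def lie_bracket_def)
  obtain C where C: "\<And>x y. norm (b x y) \<le> C * norm x * norm y"
    using b unfolding hilbert_lie_bracket_def by blast
  have "bounded_bilinear b"
  proof
    show "\<exists>K. \<forall>a c. norm (b a c) \<le> norm a * norm c * K"
      by (rule exI[of _ C]) (use C in \<open>simp add: mult_ac\<close>)
  qed (simp_all add: bilinear_ladd[OF bilb] bilinear_radd[OF bilb] bilinear_lmul[OF bilb] bilinear_rmul[OF bilb])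
  then have "(\<lambda>n. b (\<iota> (u n)) (\<iota> (v n))) \<longlonglongrightarrow> b x y"
    by (rule bounded_bilinear.tendsto) (rule u v)+
  then have "(\<lambda>n. \<iota> (brK (u n) (v n))) \<longlonglongrightarrow> b x y"
    using ext u(1) v(1) by (simp add: extends_bracket_def)
  then show ?thesis
    unfolding completed_commutator_def
    using u v by (intro exI[of _ u] exI[of _ v]) (auto intro: tendsto_inner)
qed

end

section \<open>A square-summable sequence whose convolution square is not square summable\<close>

text \<open>
  The function \<open>\<Sum>n. a n * t ^ n\<close> lies in the Hardy space \<open>H\<^sup>2\<close> while its square does not. With
  \<open>a n = n powr (-3/4)\<close> the squares \<open>n powr (-3/2)\<close> are summable, but the \<open>n\<close>-th coefficient of the
  Cauchy square is at least \<open>(n - 1) * n powr (-3/2)\<close>, of order \<open>n powr (-1/2)\<close>.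
\<close>

lemma square_of_l2_sequence_not_l2:
  obtains a :: "nat \<Rightarrow> real"
  where "a 0 = 0" "summable (\<lambda>n. (a n)\<^sup>2)" "\<not> summable (\<lambda>n. (\<Sum>j\<le>n. a j * a (n - j))\<^sup>2)"
proof -
  define a :: "nat \<Rightarrow> real" where "a n = real n powr (- 3 / 4)" for n
  let ?c = "\<lambda>n. \<Sum>j\<le>n. a j * a (n - j)"
  have a0: "a 0 = 0" and nonneg: "a n \<ge> 0" for n by (simp_all add: a_def)
  have "(a n)\<^sup>2 = real n powr (- 3 / 2)" for n
    by (simp add: a_def power2_eq_square flip: powr_add)
  then have 1: "summable (\<lambda>n. (a n)\<^sup>2)" by (simp add: summable_real_powr_iff)
  have lower: "real n powr - 1 \<le> 4 * (?c n)\<^sup>2" if n: "n \<ge> 2" for n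
  proof -
    have anti: "a n \<le> a j" if "1 \<le> j" "j \<le> n" for j
      unfolding a_def using that by (intro powr_mono2') auto
    have "real (n - 1) * (a n * a n) = (\<Sum>j\<in>{1..<n}. a n * a n)" by simp
    also have "\<dots> \<le> (\<Sum>j\<in>{1..<n}. a j * a (n - j))"
      by (intro sum_mono mult_mono anti nonneg) auto
    also have "\<dots> \<le> ?c n" by (intro sum_mono2 mult_nonneg_nonneg nonneg) auto
    finally have "real (n - 1) * (a n * a n) \<le> ?c n" .
    moreover have "real n / 2 * (a n * a n) \<le> real (n - 1) * (a n * a n)"
      using n nonneg by (intro mult_right_mono) auto
    ultimately have "real n / 2 * (a n * a n) \<le> ?c n" by linarith
    then have "(real n / 2 * (a n * a n))\<^sup>2 \<le> (?c n)\<^sup>2"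
      using nonneg by (intro power_mono) auto
    moreover have "a n * a n * (a n * a n) = real n powr - 3"
      by (simp add: a_def flip: powr_add)
    then have "(real n / 2 * (a n * a n))\<^sup>2 = real n ^ 2 / 4 * real n powr - 3"
      by (simp add: power2_eq_square mult_ac)
    moreover have "real n ^ 2 * real n powr - 3 = real n powr - 1"
    proof -
      have "real n ^ 2 = real n powr 2" by simp
      then have "real n ^ 2 * real n powr - 3 = real n powr (2 + - 3)" by (simp only: powr_add)
      then show ?thesis by simp
    qed
    ultimately show ?thesis by simp
  qed
  have "\<not> summable (\<lambda>n. (?c n)\<^sup>2)"
  proof
    assume "summable (\<lambda>n. (?c n)\<^sup>2)"
    then have "summable (\<lambda>n. 4 * (?c n)\<^sup>2)" by (rule summable_mult)
    then have "summable (\<lambda>n. real n powr - 1)"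
      by (rule summable_comparison_test'[where N = 2]) (use lower in simp)
    then show False by (simp only: summable_real_powr_iff)
  qed
  with a0 1 show thesis by (rule that)
qed

text \<open>
  Coefficients of the symmetric (\<open>\<sigma> = 1\<close>) or antisymmetric (\<open>\<sigma> = sgn\<close>) extension of a one-sided
  sequence to the integers, cut off at \<open>N\<close>.
\<close>

definition truncation :: "(int \<Rightarrow> real) \<Rightarrow> (nat \<Rightarrow> real) \<Rightarrow> nat \<Rightarrow> int \<Rightarrow> real" where
  "truncation \<sigma> a N m = \<sigma> m * (if \<bar>m\<bar> \<le> int N then a (nat \<bar>m\<bar>) else 0)"

abbreviation "even_truncation \<equiv> truncation (\<lambda>_. 1)"
abbreviation "odd_truncation \<equiv> truncation (\<lambda>m. of_int (sgn m))"

text \<open>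
  This is the identity \<open>(P + P') (P - P') = P\<^sup>2 - P'\<^sup>2\<close> for \<open>P = \<Sum>n>0. a n * t ^ n\<close> and
  \<open>P'\<close> the same series in the inverse of \<open>t\<close>: the mixed products cancel. In coefficients, the
  symmetry \<open>m \<mapsto> k - m\<close> replaces \<open>sgn (k - m)\<close> by its average with \<open>sgn m\<close>, which vanishes unless
  \<open>0 \<le> m \<le> k\<close>. The truncation is exact for these coefficients because only indices up to \<open>k \<le> N\<close>
  contribute.
\<close>

lemma even_odd_convolution_nonneg:
  assumes a0: "a 0 = 0" and k: "0 \<le> k" "k \<le> int N"
  shows "(\<Sum>m\<in>{- int N..int N}. even_truncation a N m * odd_truncation a N (k - m)) =
    (\<Sum>j\<le>nat k. a j * a (nat k - j))"
proof -
  let ?I = "{- int N..int N + k}"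
  let ?e = "even_truncation a N"
  have o: "odd_truncation a N m = of_int (sgn m) * ?e m" for m by (simp add: truncation_def)
  \<comment> \<open>The larger index set is invariant under \<open>m \<mapsto> k - m\<close>.\<close>
  have "(\<Sum>m\<in>{- int N..int N}. ?e m * odd_truncation a N (k - m)) =
      (\<Sum>m\<in>?I. ?e m * odd_truncation a N (k - m))" (is "?S = _")
    by (rule sum.mono_neutral_left) (use k in \<open>auto simp: truncation_def\<close>)
  then have S1: "?S = (\<Sum>m\<in>?I. ?e m * ?e (k - m) * of_int (sgn (k - m)))"
    by (simp add: o mult_ac)
  also have "\<dots> = (\<Sum>m\<in>?I. ?e m * ?e (k - m) * of_int (sgn m))"
    by (rule sum.reindex_bij_witness[of _ "\<lambda>m. k - m" "\<lambda>m. k - m"]) (auto simp: mult_ac)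
  finally have S2: "?S = (\<Sum>m\<in>?I. ?e m * ?e (k - m) * of_int (sgn m))" .
  have "2 * ?S = (\<Sum>m\<in>?I. ?e m * ?e (k - m) * of_int (sgn m + sgn (k - m)))"
    using S1 S2 by (simp add: sum.distrib distrib_left)
  also have "\<dots> = (\<Sum>m\<in>{0..k}. ?e m * ?e (k - m) * of_int (sgn m + sgn (k - m)))"
    by (rule sum.mono_neutral_right) (use k in auto)
  also have "\<dots> = (\<Sum>m\<in>{0..k}. 2 * (a (nat m) * a (nat k - nat m)))"
  proof (rule sum.cong[OF refl])
    fix m assume m: "m \<in> {0..k}"
    consider "m = 0" | "m = k" | "0 < m" "m < k" using m by fastforce
    then show "?e m * ?e (k - m) * of_int (sgn m + sgn (k - m)) = 2 * (a (nat m) * a (nat k - nat m))"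
    proof cases
      case 3
      then show ?thesis using k by (simp add: truncation_def nat_diff_distrib)
    qed (simp_all add: truncation_def a0)
  qed
  also have "\<dots> = (\<Sum>j\<le>nat k. 2 * (a j * a (nat k - j)))"
    by (rule sum.reindex_bij_witness[of _ int nat]) (use k in auto)
  finally show ?thesis by (simp flip: sum_distrib_left)
qed

lemma even_odd_convolution:
  assumes a0: "a 0 = 0" and k: "\<bar>k\<bar> \<le> int N"
  shows "(\<Sum>m\<in>{- int N..int N}. even_truncation a N m * odd_truncation a N (k - m)) =
    odd_truncation (\<lambda>n. \<Sum>j\<le>n. a j * a (n - j)) N k"
proof (cases "k \<ge> 0")
  case True
  then show ?thesis
    using even_odd_convolution_nonneg[where a = a, OF a0, of k N] k
    by (cases "k = 0") (simp_all add: truncation_def a0)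
next
  case False
  have "(\<Sum>m\<in>{- int N..int N}. even_truncation a N m * odd_truncation a N (k - m)) =
      (\<Sum>m\<in>{- int N..int N}. even_truncation a N (- m) * odd_truncation a N (k - - m))"
    by (rule sum_int_reflect[symmetric]) auto
  also have "\<dots> = (\<Sum>m\<in>{- int N..int N}. - (even_truncation a N m * odd_truncation a N (- k - m)))"
  proof (rule sum.cong[OF refl])
    fix m
    have "k - - m = - (- k - m)" by simp
    moreover have "even_truncation a N (- j) = even_truncation a N j"
      "odd_truncation a N (- j) = - odd_truncation a N j" for j
      by (simp_all add: truncation_def sgn_minus)
    ultimately show "even_truncation a N (- m) * odd_truncation a N (k - - m) =
        - (even_truncation a N m * odd_truncation a N (- k - m))"
      by (simp only: mult_minus_right)
  qed
  also have "\<dots> = - (\<Sum>j\<le>nat (- k). a j * a (nat (- k) - j))"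
    using even_odd_convolution_nonneg[where a = a, OF a0, of "- k" N] k False by (simp add: sum_negf)
  also have "\<dots> = odd_truncation (\<lambda>n. \<Sum>j\<le>n. a j * a (n - j)) N k"
    using False k by (simp add: truncation_def)
  finally show ?thesis .
qed

lemma sum_symmetric_interval_le:
  fixes F :: "nat \<Rightarrow> real"
  assumes "\<And>n. F n \<ge> 0"
  shows "(\<Sum>m\<in>{- int N..int N}. F (nat \<bar>m\<bar>)) \<le> 2 * (\<Sum>n\<le>N. F n)"
proof (induction N)
  case 0
  then show ?case using assms[of 0] by simp
next
  case (Suc N)
  have eq: "{- int (Suc N)..int (Suc N)} =
      insert (int (Suc N)) (insert (- int (Suc N)) {- int N..int N})" by auto
  have "(\<Sum>m\<in>{- int (Suc N)..int (Suc N)}. F (nat \<bar>m\<bar>)) =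
      2 * F (Suc N) + (\<Sum>m\<in>{- int N..int N}. F (nat \<bar>m\<bar>))"
    unfolding eq by (simp add: nat_add_distrib del: of_nat_Suc)
  then show ?case using Suc by simp
qed

section \<open>The missing commutator\<close>

definition scalar_loop :: "(int \<Rightarrow> real) \<Rightarrow> 'a::real_vector \<Rightarrow> (int \<Rightarrow>\<^sub>0 'a)" where
  "scalar_loop g x = Abs_poly_mapping (\<lambda>n. g n *\<^sub>R x)"

lemma lookup_scalar_loop:
  "Poly_Mapping.lookup (scalar_loop (truncation \<sigma> a N) x) n = truncation \<sigma> a N n *\<^sub>R x"
proof -
  have "{n. truncation \<sigma> a N n *\<^sub>R x \<noteq> 0} \<subseteq> {- int N..int N}"
    by (auto simp: truncation_def split: if_splits)
  then have "finite {n. truncation \<sigma> a N n *\<^sub>R x \<noteq> 0}" by (rule finite_subset) simp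
  then show ?thesis unfolding scalar_loop_def by simp
qed

lemma keys_scalar_loop:
  "Poly_Mapping.keys (scalar_loop (truncation \<sigma> a N) x) \<subseteq> {- int N..int N}"
  by (auto simp: in_keys_iff lookup_scalar_loop truncation_def split: if_splits)

context loop_completion
begin

lemma even_loop_in_K: "\<omega> x = x \<Longrightarrow> (scalar_loop (even_truncation a N) x, 0, 0) \<in> K"
  by (simp add: K_iff lookup_scalar_loop truncation_def linear_0[OF omega_linear]
      linear_scale[OF omega_linear])

lemma odd_loop_in_K: "\<omega> x = - x \<Longrightarrow> (scalar_loop (odd_truncation a N) x, 0, 0) \<in> K"
  by (simp add: K_iff lookup_scalar_loop truncation_def linear_0[OF omega_linear]
      linear_scale[OF omega_linear] sgn_minus)

text \<open>
  Square distances of the truncations are dominated by tails of \<open>\<Sum>n. (a n)\<^sup>2\<close>, the factor 2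
  accounting for positive and negative exponents.
\<close>

lemma truncations_convergent:
  assumes K: "\<And>N. (scalar_loop (truncation \<sigma> a N) x, 0, 0) \<in> K"
    and \<sigma>: "\<And>m. (\<sigma> m)\<^sup>2 \<le> 1" and a: "summable (\<lambda>n. (a n)\<^sup>2)"
  shows "convergent (\<lambda>N. \<iota> (scalar_loop (truncation \<sigma> a N) x, 0, 0))"
proof -
  let ?u = "\<lambda>N. (scalar_loop (truncation \<sigma> a N) x, 0, 0) :: 'a affine"
  let ?s = "\<lambda>N. 2 * coeff_inner x x * (\<Sum>n\<le>N. (a n)\<^sup>2)"
  have le: "(norm (\<iota> (?u N) - \<iota> (?u M)))\<^sup>2 \<le> ?s N - ?s M" if MN: "M \<le> N" for M N
  proof -
    let ?D = "scalar_loop (truncation \<sigma> a N) x - scalar_loop (truncation \<sigma> a M) x"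
    let ?I = "{- int N..int N}"
    let ?F = "\<lambda>n. if n \<le> M then 0 else (a n)\<^sup>2"
    have D: "?u N - ?u M = (?D, 0, 0)" by (simp add: zero_prod_def)
    have DK: "(?D, 0, 0) \<in> K" using subspace_diff[OF subspace_K K K, of N M] unfolding D .
    have keys: "Poly_Mapping.keys ?D \<subseteq> ?I"
      using MN by (auto simp: in_keys_iff lookup_minus lookup_scalar_loop truncation_def split: if_splits)
    have "(norm (\<iota> (?u N) - \<iota> (?u M)))\<^sup>2 = \<iota> (?D, 0, 0) \<bullet> \<iota> (?D, 0, 0)"
      unfolding iota_diff[OF K K, symmetric] D by (rule power2_norm_eq_inner)
    also have "\<dots> = (\<Sum>n\<in>?I. (truncation \<sigma> a N n - truncation \<sigma> a M n)\<^sup>2 * coeff_inner x x)"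
      by (simp add: inner_K[OF DK DK _ keys] lookup_minus lookup_scalar_loop power2_eq_square
          bilinear_lmul[OF coeff_inner_bilinear] bilinear_rmul[OF coeff_inner_bilinear] mult_ac
          flip: scaleR_diff_left)
    also have "\<dots> \<le> (\<Sum>n\<in>?I. ?F (nat \<bar>n\<bar>) * coeff_inner x x)"
    proof (rule sum_mono, rule mult_right_mono[OF _ coeff_inner_nonneg])
      fix n assume "n \<in> ?I"
      then have "truncation \<sigma> a N n - truncation \<sigma> a M n = \<sigma> n * (if nat \<bar>n\<bar> \<le> M then 0 else a (nat \<bar>n\<bar>))"
        using MN by (auto simp: truncation_def)
      then show "(truncation \<sigma> a N n - truncation \<sigma> a M n)\<^sup>2 \<le> ?F (nat \<bar>n\<bar>)"
        using mult_right_mono[OF \<sigma>[of n], of "(a (nat \<bar>n\<bar>))\<^sup>2"] by (simp add: power_mult_distrib)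
    qed
    also have "\<dots> \<le> 2 * (\<Sum>n\<le>N. ?F n) * coeff_inner x x"
      unfolding sum_distrib_right[symmetric]
      by (intro mult_right_mono coeff_inner_nonneg sum_symmetric_interval_le) simp
    also have "(\<Sum>n\<le>N. ?F n) = (\<Sum>n\<le>N. (a n)\<^sup>2) - (\<Sum>n\<le>M. (a n)\<^sup>2)"
    proof -
      have "(\<Sum>n\<le>N. (a n)\<^sup>2) = (\<Sum>n\<le>N. ?F n) + (\<Sum>n\<le>N. if n \<le> M then (a n)\<^sup>2 else 0)"
        by (subst sum.distrib[symmetric]) (auto intro: sum.cong)
      also have "(\<Sum>n\<le>N. if n \<le> M then (a n)\<^sup>2 else 0) = (\<Sum>n\<le>M. (a n)\<^sup>2)"
        by (rule sum.mono_neutral_cong_right) (use MN in auto)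
      finally show ?thesis by simp
    qed
    finally show ?thesis by (simp add: algebra_simps)
  qed
  have "(\<lambda>N. \<Sum>n\<le>N. (a n)\<^sup>2) \<longlonglongrightarrow> suminf (\<lambda>n. (a n)\<^sup>2)"
    using a by (rule summable_LIMSEQ')
  then have "?s \<longlonglongrightarrow> 2 * coeff_inner x x * suminf (\<lambda>n. (a n)\<^sup>2)" by (rule tendsto_mult_left)
  then have s: "Cauchy ?s" by (rule LIMSEQ_imp_Cauchy)
  have "Cauchy (\<lambda>N. \<iota> (?u N))"
  proof (rule metric_CauchyI)
    fix \<epsilon> :: real assume \<epsilon>: "\<epsilon> > 0"
    then obtain M0 where M0: "\<And>m n. m \<ge> M0 \<Longrightarrow> n \<ge> M0 \<Longrightarrow> dist (?s m) (?s n) < \<epsilon>\<^sup>2"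
      using metric_CauchyD[OF s, of "\<epsilon>\<^sup>2"] by auto
    have less: "dist (\<iota> (?u n)) (\<iota> (?u m)) < \<epsilon>" if mn: "m \<ge> M0" "n \<ge> M0" "m \<le> n" for m n
    proof -
      have "(dist (\<iota> (?u n)) (\<iota> (?u m)))\<^sup>2 \<le> ?s n - ?s m"
        unfolding dist_norm by (rule le) (rule mn(3))
      also have "\<dots> \<le> dist (?s n) (?s m)" unfolding dist_real_def by (rule abs_ge_self)
      also have "\<dots> < \<epsilon>\<^sup>2" by (rule M0) (use mn in auto)
      finally have "(dist (\<iota> (?u n)) (\<iota> (?u m)))\<^sup>2 < \<epsilon>\<^sup>2" .
      from this less_imp_le[OF \<epsilon>] show ?thesis by (rule power2_less_imp_less)
    qed
    have "dist (\<iota> (?u m)) (\<iota> (?u n)) < \<epsilon>" if mn: "m \<ge> M0" "n \<ge> M0" for m n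
    proof (cases "m \<le> n")
      case True
      show ?thesis by (subst dist_commute) (rule less[OF mn True])
    next
      case False
      then have "n \<le> m" by simp
      then show ?thesis by (rule less[OF mn(2,1)])
    qed
    then show "\<exists>M. \<forall>m\<ge>M. \<forall>n\<ge>M. dist (\<iota> (?u m)) (\<iota> (?u n)) < \<epsilon>" by blast
  qed
  then show ?thesis by (rule Cauchy_convergent)
qed

text \<open>
  The commutator would have the coefficients of \<open>(P\<^sup>2 - P'\<^sup>2) \<otimes> [x,y]\<close>. Its truncations \<open>W N\<close>
  belong to the fixed algebra, and a vector \<open>Z\<close> representing the commutator pairs with \<open>W N\<close> to
  the square norm of \<open>W N\<close>. Then all \<open>W N\<close> are bounded by \<open>Z\<close> in norm, against the choice of \<open>a\<close>.
\<close>

lemma commutator_missing: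
  assumes x: "\<omega> x = x" and y: "\<omega> y = - y" and xy: "br x y \<noteq> 0"
  shows "\<exists>X Y. \<not> (\<exists>Z. completed_commutator K brK \<iota> X Y Z)"
proof -
  obtain a :: "nat \<Rightarrow> real" where a0: "a 0 = 0" and a: "summable (\<lambda>n. (a n)\<^sup>2)"
    and conv: "\<not> summable (\<lambda>n. (\<Sum>j\<le>n. a j * a (n - j))\<^sup>2)"
    by (rule square_of_l2_sequence_not_l2)
  define d where "d = (\<lambda>n. \<Sum>j\<le>n. a j * a (n - j))"
  define z where "z = br x y"
  define P where "P N = scalar_loop (even_truncation a N) x" for N
  define Q where "Q N = scalar_loop (odd_truncation a N) y" for N
  define W where "W N = scalar_loop (odd_truncation d N) z" for N
  have z: "\<omega> z = - z" by (simp add: z_def omega_br x y bilinear_rneg[OF bil])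
  have PK: "(P N, 0, 0) \<in> K" for N unfolding P_def using x by (rule even_loop_in_K)
  have QK: "(Q N, 0, 0) \<in> K" for N unfolding Q_def using y by (rule odd_loop_in_K)
  have WK: "(W N, 0, 0) \<in> K" for N unfolding W_def using z by (rule odd_loop_in_K)
  have "convergent (\<lambda>N. \<iota> (P N, 0, 0))"
    unfolding P_def using truncations_convergent[OF PK[unfolded P_def] _ a] by simp
  then obtain X where X: "(\<lambda>N. \<iota> (P N, 0, 0)) \<longlonglongrightarrow> X" unfolding convergent_def by blast
  have "(real_of_int (sgn m))\<^sup>2 \<le> 1" for m :: int by (simp add: sgn_if)
  then have "convergent (\<lambda>N. \<iota> (Q N, 0, 0))"
    unfolding Q_def using truncations_convergent[OF QK[unfolded Q_def] _ a] by simp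
  then obtain Y where Y: "(\<lambda>N. \<iota> (Q N, 0, 0)) \<longlonglongrightarrow> Y" unfolding convergent_def by blast
  define q where "q N = (\<Sum>n\<in>{- int N..int N}. (odd_truncation d N n)\<^sup>2 * coeff_inner z z)" for N
  have norm_W: "(norm (\<iota> (W N, 0, 0)))\<^sup>2 = q N" for N
    unfolding power2_norm_eq_inner q_def
    by (subst inner_K[OF WK WK _ keys_scalar_loop[of "\<lambda>m. of_int (sgn m)" d N z, folded W_def]])
       (simp_all add: W_def lookup_scalar_loop bilinear_lmul[OF coeff_inner_bilinear]
          bilinear_rmul[OF coeff_inner_bilinear] power2_eq_square mult_ac)
  \<comment> \<open>From \<open>M = N\<close> on, enlarging the truncation no longer changes the coefficients that \<open>W N\<close> tests.\<close>
  have pairing: "\<iota> (brK (P M, 0, 0) (Q M, 0, 0)) \<bullet> \<iota> (W N, 0, 0) = q N" if "N \<le> M" for M N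
  proof -
    let ?R = "loop_bracket br (P M) (Q M)"
    have R: "Poly_Mapping.lookup ?R n = odd_truncation d N n *\<^sub>R z" if n: "n \<in> {- int N..int N}" for n
    proof -
      have "Poly_Mapping.lookup ?R n =
          (\<Sum>m\<in>{- int M..int M}. even_truncation a M m * odd_truncation a M (n - m)) *\<^sub>R z"
        unfolding P_def Q_def lookup_loop_bracket[OF bil finite_atLeastAtMost_int keys_scalar_loop]
        by (simp add: lookup_scalar_loop bilinear_lmul[OF bil] bilinear_rmul[OF bil] z_def
            scaleR_sum_left mult.commute)
      also have "\<dots> = odd_truncation d M n *\<^sub>R z"
        unfolding d_def using n \<open>N \<le> M\<close> by (subst even_odd_convolution[where a = a, OF a0]) auto
      also have "odd_truncation d M n = odd_truncation d N n"
        using n \<open>N \<le> M\<close> by (auto simp: truncation_def)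
      finally show ?thesis .
    qed
    have "\<iota> (brK (P M, 0, 0) (Q M, 0, 0)) \<bullet> \<iota> (W N, 0, 0) = \<iota> (W N, 0, 0) \<bullet> \<iota> (?R, 0, 0)"
      by (simp only: bracket_K(1)[OF PK QK] inner_commute)
    also have "\<dots> = (\<Sum>n\<in>{- int N..int N}. coeff_inner (Poly_Mapping.lookup (W N) n) (Poly_Mapping.lookup ?R n))"
      by (rule inner_K[OF WK bracket_K(2)[OF PK QK]]) (simp_all add: W_def keys_scalar_loop)
    also have "\<dots> = q N"
      unfolding q_def
      by (intro sum.cong refl) (simp add: R W_def lookup_scalar_loop bilinear_lmul[OF coeff_inner_bilinear]
          bilinear_rmul[OF coeff_inner_bilinear] power2_eq_square)
    finally show ?thesis .
  qed
  have "\<not> completed_commutator K brK \<iota> X Y Z" for Z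
  proof
    assume "completed_commutator K brK \<iota> X Y Z"
    then obtain u v where u: "\<And>n. u n \<in> K" "(\<lambda>n. \<iota> (u n)) \<longlonglongrightarrow> X"
      and v: "\<And>n. v n \<in> K" "(\<lambda>n. \<iota> (v n)) \<longlonglongrightarrow> Y"
      and lim: "\<And>w. w \<in> K \<Longrightarrow> (\<lambda>n. \<iota> (brK (u n) (v n)) \<bullet> \<iota> w) \<longlonglongrightarrow> Z \<bullet> \<iota> w"
      unfolding completed_commutator_def by blast
    \<comment> \<open>The approximations \<open>u\<close> and \<open>v\<close> are arbitrary, but may be replaced by \<open>P\<close> and \<open>Q\<close>.\<close>
    have Zq: "Z \<bullet> \<iota> (W N, 0, 0) = q N" for N
    proof -
      have "(\<lambda>M. \<iota> (brK (u M) (v M)) \<bullet> \<iota> (W N, 0, 0)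
          - \<iota> (brK (P M, 0, 0) (Q M, 0, 0)) \<bullet> \<iota> (W N, 0, 0)) \<longlonglongrightarrow> 0"
        by (rule commutator_pairing_independent[OF u PK X v QK Y WK])
      moreover have "(\<lambda>M. \<iota> (brK (P M, 0, 0) (Q M, 0, 0)) \<bullet> \<iota> (W N, 0, 0)) \<longlonglongrightarrow> q N"
        using pairing by (intro tendsto_eventually eventually_sequentiallyI[of N])
      ultimately have "(\<lambda>M. (\<iota> (brK (u M) (v M)) \<bullet> \<iota> (W N, 0, 0)
          - \<iota> (brK (P M, 0, 0) (Q M, 0, 0)) \<bullet> \<iota> (W N, 0, 0))
          + \<iota> (brK (P M, 0, 0) (Q M, 0, 0)) \<bullet> \<iota> (W N, 0, 0)) \<longlonglongrightarrow> 0 + q N"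
        by (rule tendsto_add)
      then have "(\<lambda>M. \<iota> (brK (u M) (v M)) \<bullet> \<iota> (W N, 0, 0)) \<longlonglongrightarrow> q N"
        by (simp only: diff_add_cancel add_0)
      with lim[OF WK] show ?thesis by (rule LIMSEQ_unique)
    qed
    have "summable (\<lambda>n. (d n)\<^sup>2 * coeff_inner z z)"
    proof (rule bounded_imp_summable)
      show "0 \<le> (d n)\<^sup>2 * coeff_inner z z" for n by (simp add: coeff_inner_nonneg)
      fix N
      have "(\<Sum>n\<le>N. (d n)\<^sup>2 * coeff_inner z z) = (\<Sum>n\<in>int ` {..N}. (odd_truncation d N n)\<^sup>2 * coeff_inner z z)"
      proof (subst sum.reindex)
        show "inj_on int {..N}" by (simp add: inj_on_def)
        have "d 0 = 0" by (simp add: d_def a0)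
        then show "(\<Sum>n\<le>N. (d n)\<^sup>2 * coeff_inner z z) =
            sum ((\<lambda>n. (odd_truncation d N n)\<^sup>2 * coeff_inner z z) \<circ> int) {..N}"
          by (intro sum.cong refl) (auto simp: truncation_def sgn_if)
      qed
      also have "\<dots> \<le> q N"
        unfolding q_def by (rule sum_mono2) (auto simp: coeff_inner_nonneg)
      also have "q N \<le> (norm Z)\<^sup>2"
      proof -
        have "q N \<le> norm Z * norm (\<iota> (W N, 0, 0))"
          using norm_cauchy_schwarz[of Z "\<iota> (W N, 0, 0)"] by (simp add: Zq)
        then have "norm (\<iota> (W N, 0, 0)) * norm (\<iota> (W N, 0, 0)) \<le> norm Z * norm (\<iota> (W N, 0, 0))"
          using norm_W[of N] by (simp add: power2_eq_square)
        then have "norm (\<iota> (W N, 0, 0)) \<le> norm Z"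
          by (cases "norm (\<iota> (W N, 0, 0)) = 0") (auto simp: mult_le_cancel_right)
        then show ?thesis unfolding norm_W[symmetric] by (intro power_mono) auto
      qed
      finally show "(\<Sum>n\<le>N. (d n)\<^sup>2 * coeff_inner z z) \<le> (norm Z)\<^sup>2" .
    qed
    moreover have "coeff_inner z z \<noteq> 0" using coeff_inner_definite xy by (auto simp: z_def)
    ultimately have "summable (\<lambda>n. (d n)\<^sup>2)"
      using summable_mult2[of "\<lambda>n. (d n)\<^sup>2 * coeff_inner z z" "1 / coeff_inner z z"] by simp
    with conv show False by (simp add: d_def)
  qed
  then show ?thesis by blast
qed

end

theorem mainTheorem3:
  fixes br :: "'a::euclidean_space \<Rightarrow> 'a \<Rightarrow> 'a"
    and A :: "'i::finite \<Rightarrow> 'i \<Rightarrow> int"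
    and e f h :: "'i \<Rightarrow> 'a"
    and \<omega> :: "'a \<Rightarrow> 'a"
    and c :: real
    and \<iota> :: "'a affine \<Rightarrow> 'h::{real_inner, complete_space}"
  assumes "split_simple_lie_algebra br A e f h"
    and "cartan_chevalley_involution br e f h \<omega>"
    and "c > 0"
    and "hilbert_completion (maximal_compact \<omega>) (\<lambda>x y. - affine_form br c x y) \<iota>"
  shows "(\<exists>x y. \<not> (\<exists>z. completed_commutator (maximal_compact \<omega>) (affine_bracket br c) \<iota> x y z)) \<and>
    \<not> (\<exists>b. hilbert_lie_bracket b \<and>
           extends_bracket (maximal_compact \<omega>) (affine_bracket br c) \<iota> b) \<and>
    \<not> (\<exists>b. lie_bracket b \<and>
           (\<forall>x y. completed_commutator (maximal_compact \<omega>) (affine_bracket br c) \<iota> x y (b x y)))"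
proof -
  have lie: "lie_bracket br" and gen: "lie_generates br (range e \<union> range f)"
    using assms(1) by (auto simp: split_simple_lie_algebra_def simple_lie_bracket_def)
  have lin: "linear \<omega>" and hom: "\<And>x y. \<omega> (br x y) = br (\<omega> x) (\<omega> y)" and wh: "\<And>i. \<omega> (h i) = - h i"
    using assms(2) by (auto simp: cartan_chevalley_involution_def)
  obtain i where i: "e i \<noteq> 0" "\<omega> (e i - f i) = e i - f i" "br (e i - f i) (h i) \<noteq> 0"
    by (rule noncommuting_even_odd[OF assms(1,2)])
  interpret loop_completion br \<omega> c \<iota>
  proof (rule loop_completion.intro)
    show "\<omega> (\<omega> x) = x" for x
      by (rule chevalley_involution_involutive[OF lie_bracket_properties(1)[OF lie] gen assms(2)])
    show "x = 0" if "\<And>y. killing_form br x y = 0" for x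
      using assms(1) i(1) that by (rule killing_form_nondegenerate)
    show "lie_bracket br" by (rule lie)
    show "linear \<omega>" by (rule lin)
    show "\<omega> (br x y) = br (\<omega> x) (\<omega> y)" for x y by (rule hom)
    show "c > 0" by (rule assms(3))
    show "hilbert_completion (maximal_compact \<omega>) (\<lambda>x y. - affine_form br c x y) \<iota>" by (rule assms(4))
  qed
  have missing: "\<exists>X Y. \<not> (\<exists>Z. completed_commutator K brK \<iota> X Y Z)"
    by (rule commutator_missing[OF i(2) wh i(3)])
  then obtain X Y where "\<not> (\<exists>Z. completed_commutator K brK \<iota> X Y Z)" by (elim exE)
  then have XY: "\<not> completed_commutator K brK \<iota> X Y Z" for Z by (rule contrapos_nn) (rule exI)
  show ?thesis
  proof (intro conjI notI)
    show "\<exists>X Y. \<not> (\<exists>Z. completed_commutator K brK \<iota> X Y Z)" by (rule missing)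
  next
    assume "\<exists>b. hilbert_lie_bracket b \<and> extends_bracket K brK \<iota> b"
    then obtain b where "hilbert_lie_bracket b" "extends_bracket K brK \<iota> b" by (elim exE conjE)
    then have "completed_commutator K brK \<iota> X Y (b X Y)"
      by (rule bounded_extension_gives_commutators)
    with XY show False by (rule notE)
  next
    assume "\<exists>b. lie_bracket b \<and> (\<forall>X Y. completed_commutator K brK \<iota> X Y (b X Y))"
    then obtain b where "\<forall>X Y. completed_commutator K brK \<iota> X Y (b X Y)" by (elim exE conjE)
    then have "completed_commutator K brK \<iota> X Y (b X Y)" by (elim allE)
    with XY show False by (rule notE)
  qed
qed

end
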